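(* Let $G=\{g_1,\ldots,g_m\}$ be a Standard Basis for the local ring $\mathcal{O}$ of an algebroid curve $Q$ with $r\ge 2$ branches. Then the semiring of values $(\Gamma,\oplus,\odot)$ of $Q$ is generated by the finite set $v(G)=\{v(g_1),\ldots,v(g_m)\}$.
   Context: Let $\mathbb{K}$ be an algebraically closed field and $n>1$. An algebroid curve in $\mathbb{K}^n$ is a proper radical ideal $Q=\bigcap_{i=1}^{r}P_i\subset\mathbb{K}[[X_1,\ldots,X_n]]$, where $P_1,\ldots,P_r$ are the (distinct) minimal primes over $Q$ (the branches) and each $\mathcal{O}_i=\mathbb{K}[[X_1,\ldots,X_n]]/P_i$ has Krull dimension one. Standing assumptions: $r\geq 2$, and $Q$ is non-degenerate, i.e. $\dim_{\mathbb{K}}\mathcal{M}/\mathcal{M}^2=n$, where $\mathcal{M}$ is the maximal ideal of $\mathcal{O}=\mathbb{K}[[X_1,\ldots,X_n]]/Q$. Put $I=\{1,\ldots,r\}$, $\mathbb{N}=\{0,1,2,\ldots\}$ and $\overline{\mathbb{N}}=\mathbb{N}\cup\{\infty\}$, with $a+\infty=\infty$ for all $a$ and $0\cdot\infty=0$. The integral closure of $\mathcal{O}_i$ in its field of fractions is a discrete valuation ring isomorphic to $\mathbb{K}[[t_i]]$, with normalized valuation $v_i$ ($v_i(0)=\infty$). For $g\in\mathcal{O}$, $v_i(g)$ denotes the value under $v_i$ of the image of $g$ in $\mathcal{O}_i$, and $v(g)=(v_1(g),\ldots,v_r(g))\in\overline{\mathbb{N}}^r$. The set of values is $\Gamma=\{v(g):g\in\mathcal{O}\}\subseteq\overline{\mathbb{N}}^r$.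 For $0\neq g\in\mathcal{O}$ put $I_g=\{i\in I: v_i(g)\neq\infty\}$. The set $\Gamma$ is closed under componentwise minimum and is a semiring with the operations $\alpha\oplus\beta=\min\{\alpha,\beta\}$ (componentwise) and $\alpha\odot\beta=\alpha+\beta$; it is called the semiring of values of $Q$. For a finite set $G=\{g_1,\ldots,g_m\}\subset\mathcal{M}$, a $G$-product is an element $G^{\alpha}=\prod_{j=1}^{m}g_j^{\alpha_j}$ with $\alpha=(\alpha_1,\ldots,\alpha_m)\in\mathbb{N}^m$. For $0\neq g\in\mathcal{O}$ and $k\in I_g$, an element $h\in\mathcal{O}$ is a $k$-reduction of $g$ modulo $G$ if there exist $c\in\mathbb{K}$ and a $G$-product $G^\alpha$ with $h=g-cG^{\alpha}$, $v_i(h)\geq v_i(g)$ for all $i\in I$, and $v_k(h)>v_k(g)$. A reduction of $g$ modulo $G$ is a $k$-reduction for some $k\in I_g$. A nonempty finite subset $G\subset\mathcal{M}\setminus\{0\}$ is a Standard Basis for $\mathcal{O}$ if every nonzero $g\in\mathcal{O}$ has a reduction modulo $G$. The semiring $\Gamma$ is generated by a finite subset $\{\gamma_1,\ldots,\gamma_m\}\subset\Gamma$ if for every $\gamma\in\Gamma$ there exist $s\leq r$ (depending on $\gamma$), $s\ge 1$, and $\alpha_{ij}\in\mathbb{N}$ ($1\leq i\leq s$, $1\leq j\leq m$) such that $\gamma=\min\{\sum_{j=1}^m\alpha_{1j}\gamma_j,\ldots,\sum_{j=1}^m\alpha_{sj}\gamma_j\}$ (componentwise minimum). *)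

theory Defs
  imports
    "HOL-Algebra.Algebra"
    "HOL-Computational_Algebra.Polynomial"
    "HOL-Library.Cardinality"
    "HOL-Library.Extended_Nat"
begin

section \<open>Commutative algebra\<close>

definition radical :: "('a, 'b) ring_scheme \<Rightarrow> 'a set \<Rightarrow> 'a set" where
  "radical R J = {x \<in> carrier R. \<exists>n::nat. x [^]\<^bsub>R\<^esub> n \<in> J}"

definition minimal_primes :: "('a, 'b) ring_scheme \<Rightarrow> 'a set \<Rightarrow> 'a set set" where
  "minimal_primes R J =
     {P. primeideal P R \<and> J \<subseteq> P \<and> (\<forall>P'. primeideal P' R \<and> J \<subseteq> P' \<and> P' \<subseteq> P \<longrightarrow> P' = P)}"

text \<open>The supremum of the lengths of chains of prime ideals \<open>p 0 \<subset> \<dots> \<subset> p d\<close>.\<close>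

definition krull_dim :: "('a, 'b) ring_scheme \<Rightarrow> enat" where
  "krull_dim R =
     (SUP d \<in> {d::nat. \<exists>p::nat \<Rightarrow> 'a set. (\<forall>i\<le>d. primeideal (p i) R) \<and> (\<forall>i<d. p i \<subset> p (Suc i))}. enat d)"

text \<open>Only meaningful for a local ring.\<close>

definition max_ideal :: "('a, 'b) ring_scheme \<Rightarrow> 'a set" where
  "max_ideal R = (THE M. maximalideal M R)"

text \<open>The field of fractions of a domain, with fractions \<open>a / b\<close> as classes of pairs \<open>(a, b)\<close>.\<close>

definition frac_rel :: "('a, 'b) ring_scheme \<Rightarrow> (('a \<times> 'a) \<times> ('a \<times> 'a)) set" where
  "frac_rel R =
     {((a, b), (c, d)) | a b c d. a \<in> carrier R \<and> c \<in> carrier R \<and>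
        b \<in> carrier R - {\<zero>\<^bsub>R\<^esub>} \<and> d \<in> carrier R - {\<zero>\<^bsub>R\<^esub>} \<and> a \<otimes>\<^bsub>R\<^esub> d = c \<otimes>\<^bsub>R\<^esub> b}"

definition fraction :: "('a, 'b) ring_scheme \<Rightarrow> 'a \<Rightarrow> 'a \<Rightarrow> ('a \<times> 'a) set" where
  "fraction R a b = frac_rel R `` {(a, b)}"

definition frac_field :: "('a, 'b) ring_scheme \<Rightarrow> ('a \<times> 'a) set ring" where
  "frac_field R =
     \<lparr> carrier = (carrier R \<times> (carrier R - {\<zero>\<^bsub>R\<^esub>})) // frac_rel R,
       monoid.mult = (\<lambda>S T. \<Union>x\<in>S. \<Union>y\<in>T. fraction R (fst x \<otimes>\<^bsub>R\<^esub> fst y) (snd x \<otimes>\<^bsub>R\<^esub> snd y)),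
       monoid.one = fraction R \<one>\<^bsub>R\<^esub> \<one>\<^bsub>R\<^esub>,
       ring.zero = fraction R \<zero>\<^bsub>R\<^esub> \<one>\<^bsub>R\<^esub>,
       ring.add = (\<lambda>S T. \<Union>x\<in>S. \<Union>y\<in>T.
                fraction R ((fst x \<otimes>\<^bsub>R\<^esub> snd y) \<oplus>\<^bsub>R\<^esub> (fst y \<otimes>\<^bsub>R\<^esub> snd x)) (snd x \<otimes>\<^bsub>R\<^esub> snd y)) \<rparr>"

text \<open>The elements of \<open>L\<close> that are roots of a monic polynomial with coefficients in the subring \<open>S\<close>.\<close>

definition integral_closure :: "('a, 'b) ring_scheme \<Rightarrow> 'a set \<Rightarrow> 'a set" where
  "integral_closure L S =
     {x \<in> carrier L. \<exists>(n::nat) a. a \<in> {..<n} \<rightarrow> S \<and>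
        (x [^]\<^bsub>L\<^esub> n) \<oplus>\<^bsub>L\<^esub> (\<Oplus>\<^bsub>L\<^esub>i\<in>{..<n}. a i \<otimes>\<^bsub>L\<^esub> (x [^]\<^bsub>L\<^esub> i)) = \<zero>\<^bsub>L\<^esub>}"

text \<open>
  \<open>v\<close> is the normalized discrete valuation of the field \<open>L\<close> with valuation ring \<open>B\<close>. The integer
  \<open>v x\<close> is only meaningful for nonzero \<open>x\<close>; the convention \<open>v 0 = \<infinity>\<close> is added in \<open>branch_value\<close>.
\<close>

definition normalized_valuation :: "('a, 'b) ring_scheme \<Rightarrow> 'a set \<Rightarrow> ('a \<Rightarrow> int) \<Rightarrow> bool" where
  "normalized_valuation L B v \<longleftrightarrow>
     v ` (carrier L - {\<zero>\<^bsub>L\<^esub>}) = UNIV \<and>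
     (\<forall>x \<in> carrier L - {\<zero>\<^bsub>L\<^esub>}. \<forall>y \<in> carrier L - {\<zero>\<^bsub>L\<^esub>}. v (x \<otimes>\<^bsub>L\<^esub> y) = v x + v y) \<and>
     (\<forall>x \<in> carrier L - {\<zero>\<^bsub>L\<^esub>}. \<forall>y \<in> carrier L - {\<zero>\<^bsub>L\<^esub>}.
        x \<oplus>\<^bsub>L\<^esub> y \<noteq> \<zero>\<^bsub>L\<^esub> \<longrightarrow> min (v x) (v y) \<le> v (x \<oplus>\<^bsub>L\<^esub> y)) \<and>
     B = {x \<in> carrier L. x \<noteq> \<zero>\<^bsub>L\<^esub> \<longrightarrow> 0 \<le> v x}"


section \<open>Formal power series in several variables\<close>

text \<open>
  A power series with variables indexed by the finite type \<open>'n\<close> is its family of coefficients,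
  indexed by exponent vectors. Exponent vectors are ordered componentwise, so the Cauchy product
  below is a finite sum.
\<close>

type_synonym ('n, 'k) mps = "('n \<Rightarrow> nat) \<Rightarrow> 'k"

definition mps_const :: "'k \<Rightarrow> ('n, 'k::zero) mps" where
  "mps_const c = (\<lambda>e. if e = (\<lambda>_. 0) then c else 0)"

definition mps_ring :: "('n::finite, 'k::field) mps ring" where
  "mps_ring =
     \<lparr> carrier = UNIV,
       monoid.mult = (\<lambda>f g e. \<Sum>d\<in>{..e}. f d * g (\<lambda>i. e i - d i)),
       monoid.one = mps_const 1,
       ring.zero = (\<lambda>_. 0),
       ring.add = (\<lambda>f g e. f e + g e) \<rparr>"


section \<open>Algebroid curves\<close>

abbreviation curve_ring :: "('n::finite, 'k::field) mps set \<Rightarrow> ('n, 'k) mps set ring" where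
  "curve_ring Q \<equiv> mps_ring Quot Q"

definition algebroid_curve ::
    "('n::finite, 'k::field) mps set \<Rightarrow> nat \<Rightarrow> (nat \<Rightarrow> ('n, 'k) mps set) \<Rightarrow> bool" where
  "algebroid_curve Q r P \<longleftrightarrow>
     ideal Q mps_ring \<and> Q \<noteq> carrier mps_ring \<and> radical mps_ring Q = Q \<and>
     inj_on P {1..r} \<and> P ` {1..r} = minimal_primes mps_ring Q \<and> Q = (\<Inter>i\<in>{1..r}. P i) \<and>
     (\<forall>i\<in>{1..r}. krull_dim (curve_ring (P i)) = 1)"

definition scalar :: "('n::finite, 'k::field) mps set \<Rightarrow> 'k \<Rightarrow> ('n, 'k) mps set" where
  "scalar Q c = Q +>\<^bsub>mps_ring\<^esub> mps_const c"

text \<open>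
  The space \<open>M / M\<^sup>2\<close> is taken inside the \<open>K\<close>-algebra \<open>O / M\<^sup>2\<close>, where \<open>K\<close> is embedded as the
  classes of the constants.
\<close>

definition nondegenerate :: "('n::finite, 'k::field) mps set \<Rightarrow> bool" where
  "nondegenerate Q \<longleftrightarrow>
     (let A = curve_ring Q; M = max_ideal A; J = M \<cdot>\<^bsub>A\<^esub> M in
        ring.dimension (A Quot J) CARD('n) (range (\<lambda>c. J +>\<^bsub>A\<^esub> scalar Q c)) ((\<lambda>x. J +>\<^bsub>A\<^esub> x) ` M))"


section \<open>Values\<close>

text \<open>\<open>w\<close> is the normalized valuation of the normalization of the branch ring \<open>K[[X]] / p\<close>.\<close>

definition branch_valuation ::
    "('n::finite, 'k::field) mps set \<Rightarrow>
     ((('n, 'k) mps set \<times> ('n, 'k) mps set) set \<Rightarrow> int) \<Rightarrow> bool" where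
  "branch_valuation p w \<longleftrightarrow>
     (let A = curve_ring p; L = frac_field A in
        normalized_valuation L (integral_closure L ((\<lambda>a. fraction A a \<one>\<^bsub>A\<^esub>) ` carrier A)) w)"

text \<open>
  For \<open>Q \<subseteq> p\<close> the image in \<open>K[[X]] / p\<close> of a coset \<open>x = Q + f\<close> is the coset \<open>p + x = p + f\<close>.
  Values of nonzero elements of the branch ring are nonnegative, so \<open>nat\<close> truncates nothing.
\<close>

definition branch_value ::
    "('n::finite, 'k::field) mps set \<Rightarrow>
     ((('n, 'k) mps set \<times> ('n, 'k) mps set) set \<Rightarrow> int) \<Rightarrow> ('n, 'k) mps set \<Rightarrow> enat" where
  "branch_value p w x =
     (let A = curve_ring p; y = p <+>\<^bsub>mps_ring\<^esub> x in
        if y = \<zero>\<^bsub>A\<^esub> then \<infinity> else enat (nat (w (fraction A y \<one>\<^bsub>A\<^esub>))))"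

text \<open>Vectors with index set \<open>{1..r}\<close> are functions that are \<open>undefined\<close> outside \<open>{1..r}\<close>.\<close>

definition value_vector ::
    "nat \<Rightarrow> (nat \<Rightarrow> ('n::finite, 'k::field) mps set) \<Rightarrow>
     (nat \<Rightarrow> (('n, 'k) mps set \<times> ('n, 'k) mps set) set \<Rightarrow> int) \<Rightarrow>
     ('n, 'k) mps set \<Rightarrow> nat \<Rightarrow> enat" where
  "value_vector r P v g = (\<lambda>i\<in>{1..r}. branch_value (P i) (v i) g)"

definition value_semiring ::
    "('n::finite, 'k::field) mps set \<Rightarrow> nat \<Rightarrow> (nat \<Rightarrow> ('n, 'k) mps set) \<Rightarrow>
     (nat \<Rightarrow> (('n, 'k) mps set \<times> ('n, 'k) mps set) set \<Rightarrow> int) \<Rightarrow> (nat \<Rightarrow> enat) set" where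
  "value_semiring Q r P v = value_vector r P v ` carrier (curve_ring Q)"

text \<open>
  Minima of at most \<open>r\<close> combinations of elements of \<open>S\<close> with coefficients in \<open>\<nat>\<close>
  (in \<^typ>\<open>enat\<close>, \<open>0 * \<infinity> = 0\<close>).
\<close>

definition semiring_generated :: "nat \<Rightarrow> (nat \<Rightarrow> enat) set \<Rightarrow> (nat \<Rightarrow> enat) set \<Rightarrow> bool" where
  "semiring_generated r \<Gamma> S \<longleftrightarrow>
     finite S \<and> S \<subseteq> \<Gamma> \<and>
     (\<forall>\<gamma>\<in>\<Gamma>. \<exists>s\<in>{1..r}. \<exists>\<alpha> :: nat \<Rightarrow> (nat \<Rightarrow> enat) \<Rightarrow> nat.
        \<gamma> = (\<lambda>k\<in>{1..r}. MIN i\<in>{1..s}. \<Sum>\<sigma>\<in>S. enat (\<alpha> i \<sigma>) * \<sigma> k))"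


section \<open>Standard bases\<close>

definition G_product ::
    "('n::finite, 'k::field) mps set \<Rightarrow> ('n, 'k) mps set set \<Rightarrow> (('n, 'k) mps set \<Rightarrow> nat) \<Rightarrow>
     ('n, 'k) mps set" where
  "G_product Q G \<alpha> = (\<Otimes>\<^bsub>curve_ring Q\<^esub>g\<in>G. g [^]\<^bsub>curve_ring Q\<^esub> \<alpha> g)"

definition k_reduction ::
    "('n::finite, 'k::field) mps set \<Rightarrow> nat \<Rightarrow> (nat \<Rightarrow> ('n, 'k) mps set) \<Rightarrow>
     (nat \<Rightarrow> (('n, 'k) mps set \<times> ('n, 'k) mps set) set \<Rightarrow> int) \<Rightarrow>
     ('n, 'k) mps set set \<Rightarrow> nat \<Rightarrow> ('n, 'k) mps set \<Rightarrow> ('n, 'k) mps set \<Rightarrow> bool" where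
  "k_reduction Q r P v G k g h \<longleftrightarrow>
     (\<exists>c \<alpha>. h = g \<ominus>\<^bsub>curve_ring Q\<^esub> (scalar Q c \<otimes>\<^bsub>curve_ring Q\<^esub> G_product Q G \<alpha>)) \<and>
     (\<forall>i\<in>{1..r}. value_vector r P v g i \<le> value_vector r P v h i) \<and>
     value_vector r P v g k < value_vector r P v h k"

definition standard_basis ::
    "('n::finite, 'k::field) mps set \<Rightarrow> nat \<Rightarrow> (nat \<Rightarrow> ('n, 'k) mps set) \<Rightarrow>
     (nat \<Rightarrow> (('n, 'k) mps set \<times> ('n, 'k) mps set) set \<Rightarrow> int) \<Rightarrow>
     ('n, 'k) mps set set \<Rightarrow> bool" where
  "standard_basis Q r P v G \<longleftrightarrow>
     finite G \<and> G \<noteq> {} \<and> G \<subseteq> max_ideal (curve_ring Q) - {\<zero>\<^bsub>curve_ring Q\<^esub>} \<and>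
     (\<forall>g \<in> carrier (curve_ring Q) - {\<zero>\<^bsub>curve_ring Q\<^esub>}.
        \<exists>k \<in> {i \<in> {1..r}. value_vector r P v g i \<noteq> \<infinity>}. \<exists>h. k_reduction Q r P v G k g h)"

end

theory Submission
  imports Defs
begin

text \<open>
  The claim amounts to one statement about a single branch: for every \<open>f\<close> and every branch \<open>k\<close>
  there is a \<open>G\<close>-product whose value agrees with \<open>v f\<close> at \<open>k\<close> and is at least \<open>v f\<close> everywhere
  else. Taking one such product for each of the \<open>r\<close> branches and forming the minimum gives
  back \<open>v f\<close>, and the value of a \<open>G\<close>-product is a combination of the values of the generators.

  A reduction \<open>f - c G\<^sup>\<alpha>\<close> provides such a product for some branch with finite value, but
  that branch cannot be prescribed. So suppose that no product serves the branch \<open>k\<close>. Then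
  reducing \<open>f\<close> again and again never changes the value at \<open>k\<close>, and the process does not stop. At
  the \<open>n\<close>-th step the product subtracted has a finite value at the branch reduced there, equal to
  the value of the current remainder. These values tend to infinity, because each branch has its
  value raised strictly whenever it is the one reduced. A product with few factors cannot have a
  large finite value, so the number of factors tends to infinity as well, and the remainders
  converge in the complete ring \<open>K[[X]]\<close>. The limit still has the value of \<open>f\<close> at \<open>k\<close> and
  dominates \<open>v f\<close>; but some branch was reduced infinitely often, and there the limit has value
  \<open>\<infinity>\<close> whereas \<open>f\<close> has not. Induction on the number of branches with finite value
  therefore gives a product that serves \<open>k\<close> for the limit, hence for \<open>f\<close>: a contradiction. This is
  lemma \<open>dominating_power_product\<close>; completeness enters through \<open>mps_ord_ge_complete\<close>.

  For branches where \<open>f\<close> has value \<open>\<infinity>\<close> it remains to see that some \<open>G\<close>-product has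
  value \<open>\<infinity>\<close> wherever \<open>f\<close> has. If \<open>f\<close> has a finite value, then any product found so far
  will do, since its value is at least \<open>v f\<close>. Let \<open>f = 0\<close>. Distinct minimal primes
  are incomparable, so some series vanishes on the branch \<open>i\<close> but not on another one; a
  product that dominates it has value \<open>\<infinity>\<close> at \<open>i\<close>, and so has one of its factors. Hence
  the product of all generators is zero.

  The values are studied as functions on \<open>K[[X]]\<close>, where sums are pointwise and limits exist.
  What has to be known about them is collected in the locale \<open>mps_valuation\<close>: they are
  valuations, and they are positive on series without constant term. The latter makes them
  compatible with limits (\<open>val_ge_if_ord_ge\<close>). It holds because the centre of the valuation on
  a branch is a nonzero prime ideal of a local domain of dimension one, hence is its maximal
  ideal (\<open>centre_eq_maximalideal\<close>).
\<close>

section \<open>The ring of power series\<close>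

lemma finite_atMost_nat_fun: "finite {..e :: 'n::finite \<Rightarrow> nat}"
proof -
  have "{..e} = (\<Pi>\<^sub>E i\<in>UNIV. {..e i})"
    by (auto simp: le_fun_def PiE_def Pi_def)
  then show ?thesis
    by (simp add: finite_PiE)
qed

definition total_degree :: "('n::finite \<Rightarrow> nat) \<Rightarrow> nat" where
  "total_degree e = (\<Sum>i\<in>UNIV. e i)"

lemma total_degree_diff:
  assumes "d \<le> e"
  shows "total_degree d + total_degree (\<lambda>i. e i - d i) = total_degree e"
proof -
  have "(\<Sum>i\<in>UNIV. d i + (e i - d i)) = (\<Sum>i\<in>UNIV. e i)"
    using assms by (intro sum.cong) (auto simp: le_fun_def)
  then show ?thesis
    by (simp add: total_degree_def sum.distrib)
qed

lemma total_degree_eq_0_iff: "total_degree e = 0 \<longleftrightarrow> e = (\<lambda>_. 0)"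
  by (auto simp: total_degree_def)

lemma carrier_mps [simp]: "carrier mps_ring = UNIV"
  and zero_mps: "\<zero>\<^bsub>mps_ring\<^esub> = (\<lambda>_. 0)"
  and one_mps: "\<one>\<^bsub>mps_ring\<^esub> = mps_const 1"
  and add_mps: "f \<oplus>\<^bsub>mps_ring\<^esub> g = (\<lambda>e. f e + g e)"
  and mult_mps: "f \<otimes>\<^bsub>mps_ring\<^esub> g = (\<lambda>e. \<Sum>d\<in>{..e}. f d * g (\<lambda>i. e i - d i))"
  by (simp_all add: mps_ring_def)

lemma mps_const_mult: "mps_const c \<otimes>\<^bsub>mps_ring\<^esub> f = (\<lambda>e. c * f e)"
proof
  fix e :: "'a \<Rightarrow> nat"
  have "(mps_const c \<otimes>\<^bsub>mps_ring\<^esub> f) e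
      = (\<Sum>d\<in>{..e}. if d = (\<lambda>_. 0) then c * f e else 0)"
    unfolding mult_mps by (intro sum.cong) (auto simp: mps_const_def)
  also have "\<dots> = c * f e"
    by (simp add: finite_atMost_nat_fun le_fun_def)
  finally show "(mps_const c \<otimes>\<^bsub>mps_ring\<^esub> f) e = c * f e" .
qed

lemma mps_mult_comm: "f \<otimes>\<^bsub>mps_ring\<^esub> g = g \<otimes>\<^bsub>mps_ring\<^esub> f"
proof
  fix e :: "'a \<Rightarrow> nat"
  show "(f \<otimes>\<^bsub>mps_ring\<^esub> g) e = (g \<otimes>\<^bsub>mps_ring\<^esub> f) e"
    unfolding mult_mps
    by (rule sum.reindex_bij_witness[of _ "\<lambda>d i. e i - d i" "\<lambda>d i. e i - d i"])
      (auto simp: le_fun_def mult.commute)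
qed

lemma mps_mult_assoc:
  "(f \<otimes>\<^bsub>mps_ring\<^esub> g) \<otimes>\<^bsub>mps_ring\<^esub> h = f \<otimes>\<^bsub>mps_ring\<^esub> (g \<otimes>\<^bsub>mps_ring\<^esub> h)"
proof
  fix e :: "'a \<Rightarrow> nat"
  have "((f \<otimes>\<^bsub>mps_ring\<^esub> g) \<otimes>\<^bsub>mps_ring\<^esub> h) e
      = (\<Sum>(d, c)\<in>(SIGMA d:{..e}. {..d}). f c * g (\<lambda>i. d i - c i) * h (\<lambda>i. e i - d i))"
    by (simp add: mult_mps sum_distrib_right sum.Sigma finite_atMost_nat_fun)
  also have "\<dots> = (\<Sum>(c, b)\<in>(SIGMA c:{..e}. {..\<lambda>i. e i - c i}).
      f c * (g b * h (\<lambda>i. e i - c i - b i)))"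
  proof (rule sum.reindex_bij_witness[of _ "\<lambda>(c, b). (\<lambda>i. c i + b i, c)"
        "\<lambda>(d, c). (c, \<lambda>i. d i - c i)"], goal_cases)
    case (1 a)
    then show ?case by (auto simp: le_fun_def)
  next
    case (2 a)
    then show ?case
      by (auto simp: le_fun_def) (blast intro: order_trans diff_le_mono)+
  next
    case (3 b)
    then show ?case by auto
  next
    case (4 b)
    then show ?case by (auto simp: le_fun_def le_diff_conv2 add.commute)
  next
    case (5 a)
    then obtain d c where a: "a = (d, c)" "c \<le> d" by auto
    then have "(\<lambda>i. e i - c i - (d i - c i)) = (\<lambda>i. e i - d i)"
      by (auto simp: le_fun_def)
    then show ?case
      using a by (simp add: mult.assoc)
  qed
  also have "\<dots> = (f \<otimes>\<^bsub>mps_ring\<^esub> (g \<otimes>\<^bsub>mps_ring\<^esub> h)) e"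
    by (simp add: mult_mps sum_distrib_left sum.Sigma finite_atMost_nat_fun)
  finally show "((f \<otimes>\<^bsub>mps_ring\<^esub> g) \<otimes>\<^bsub>mps_ring\<^esub> h) e
      = (f \<otimes>\<^bsub>mps_ring\<^esub> (g \<otimes>\<^bsub>mps_ring\<^esub> h)) e" .
qed

lemma cring_mps_ring: "cring (mps_ring :: ('n::finite, 'k::field) mps ring)"
proof (rule cringI)
  show "abelian_group (mps_ring :: ('n, 'k) mps ring)"
  proof (rule abelian_groupI)
    fix f :: "('n, 'k) mps"
    show "\<exists>g\<in>carrier mps_ring. g \<oplus>\<^bsub>mps_ring\<^esub> f = \<zero>\<^bsub>mps_ring\<^esub>"
      by (rule bexI[of _ "\<lambda>e. - f e"]) (auto simp: add_mps zero_mps)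
  qed (auto simp: add_mps zero_mps algebra_simps)
  show "Group.comm_monoid (mps_ring :: ('n, 'k) mps ring)"
    by (rule comm_monoidI) (auto simp: mps_mult_assoc one_mps mps_const_mult intro: mps_mult_comm)
qed (auto simp: add_mps mult_mps algebra_simps sum.distrib)

interpretation mps: cring "mps_ring :: ('n::finite, 'k::field) mps ring"
  by (rule cring_mps_ring)

lemma uminus_mps: "\<ominus>\<^bsub>mps_ring\<^esub> g = (\<lambda>e. - g e)"
  by (rule mps.minus_equality) (auto simp: add_mps zero_mps)

lemma minus_mps: "f \<ominus>\<^bsub>mps_ring\<^esub> g = (\<lambda>e. f e - g e)"
  by (simp add: mps.minus_eq uminus_mps add_mps)

lemma minus_minus_mps: "f \<ominus>\<^bsub>mps_ring\<^esub> (f \<ominus>\<^bsub>mps_ring\<^esub> g) = g"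
  by (simp add: minus_mps)

lemma atMost_zero_fun: "{..(\<lambda>_. 0 :: nat)} = {\<lambda>_. 0}"
  by (auto simp: le_fun_def)

lemma mult_mps_0: "(f \<otimes>\<^bsub>mps_ring\<^esub> g) (\<lambda>_. 0) = f (\<lambda>_. 0) * g (\<lambda>_. 0)"
  by (simp add: mult_mps atMost_zero_fun)

text \<open>The coefficients of the inverse are determined by recursion on the total degree.\<close>

function mps_inverse :: "('n::finite, 'k::field) mps \<Rightarrow> ('n, 'k) mps" where
  "mps_inverse f e =
     (if e = (\<lambda>_. 0) then inverse (f (\<lambda>_. 0))
      else - inverse (f (\<lambda>_. 0)) *
        (\<Sum>d\<in>{..e} - {\<lambda>_. 0}. f d * mps_inverse f (\<lambda>i. e i - d i)))"
  by auto
termination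
proof (relation "measure (\<lambda>(f, e). total_degree e)")
  fix f :: "('n::finite, 'k::field) mps" and e d :: "'n \<Rightarrow> nat"
  assume d: "d \<in> {..e} - {\<lambda>_. 0}"
  then have "total_degree d \<noteq> 0"
    by (simp add: total_degree_eq_0_iff)
  moreover have "total_degree d + total_degree (\<lambda>i. e i - d i) = total_degree e"
    using d by (intro total_degree_diff) auto
  ultimately show "((f, \<lambda>i. e i - d i), (f, e)) \<in> measure (\<lambda>(f, e). total_degree e)"
    by simp
qed auto

declare mps_inverse.simps [simp del]

lemma Units_mps_iff: "f \<in> Units mps_ring \<longleftrightarrow> f (\<lambda>_. 0) \<noteq> 0"
proof
  assume "f \<in> Units mps_ring"
  then obtain g where "f \<otimes>\<^bsub>mps_ring\<^esub> g = mps_const 1"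
    by (auto simp: Units_def one_mps)
  then have "f (\<lambda>_. 0) * g (\<lambda>_. 0) = 1"
    by (metis mult_mps_0 mps_const_def)
  then show "f (\<lambda>_. 0) \<noteq> 0"
    by auto
next
  assume f0: "f (\<lambda>_. 0) \<noteq> 0"
  have "f \<otimes>\<^bsub>mps_ring\<^esub> mps_inverse f = \<one>\<^bsub>mps_ring\<^esub>"
  proof
    fix e :: "'a \<Rightarrow> nat"
    have "(f \<otimes>\<^bsub>mps_ring\<^esub> mps_inverse f) e = f (\<lambda>_. 0) * mps_inverse f e
        + (\<Sum>d\<in>{..e} - {\<lambda>_. 0}. f d * mps_inverse f (\<lambda>i. e i - d i))"
      by (simp add: mult_mps sum.remove[of "{..e}" "\<lambda>_. 0"] finite_atMost_nat_fun le_fun_def)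
    also have "\<dots> = mps_const 1 e"
    proof (cases "e = (\<lambda>_. 0)")
      case True
      then show ?thesis
        using f0
        by (simp add: mps_inverse.simps[of f "\<lambda>_. 0"] mps_const_def atMost_zero_fun)
    next
      case False
      then show ?thesis
        using f0 by (simp add: mps_inverse.simps[of f e] mps_const_def)
    qed
    finally show "(f \<otimes>\<^bsub>mps_ring\<^esub> mps_inverse f) e = \<one>\<^bsub>mps_ring\<^esub> e"
      by (simp add: one_mps)
  qed
  then show "f \<in> Units mps_ring"
    using mps_mult_comm[of f "mps_inverse f"] by (auto simp: Units_def)
qed

section \<open>The order filtration\<close>

definition mps_ord_ge :: "nat \<Rightarrow> ('n::finite, 'k::field) mps set" where
  "mps_ord_ge m = {f. \<forall>e. total_degree e < m \<longrightarrow> f e = 0}"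

lemma mps_ord_ge_1: "mps_ord_ge 1 = {f. f (\<lambda>_. 0) = 0}"
  by (auto simp: mps_ord_ge_def total_degree_eq_0_iff)

lemma mps_ord_ge_mult:
  assumes "f \<in> mps_ord_ge m" "g \<in> mps_ord_ge l"
  shows "f \<otimes>\<^bsub>mps_ring\<^esub> g \<in> mps_ord_ge (m + l)"
proof -
  have "f d * g (\<lambda>i. e i - d i) = 0" if "total_degree e < m + l" "d \<le> e" for e d
    using that assms total_degree_diff[OF that(2)]
    by (cases "total_degree d < m") (auto simp: mps_ord_ge_def)
  then show ?thesis
    by (auto simp: mps_ord_ge_def mult_mps intro!: sum.neutral)
qed

lemma mps_ord_ge_pow:
  assumes "f \<in> mps_ord_ge m"
  shows "f [^]\<^bsub>mps_ring\<^esub> (a::nat) \<in> mps_ord_ge (a * m)"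
proof (induction a)
  case 0
  show ?case by (simp add: mps_ord_ge_def)
next
  case (Suc a)
  then show ?case
    using mps_ord_ge_mult[OF Suc assms] by (simp add: add.commute)
qed

lemma ideal_mps_ord_ge: "ideal (mps_ord_ge m :: ('n::finite, 'k::field) mps set) mps_ring"
proof (rule idealI[OF mps.ring_axioms])
  show "subgroup (mps_ord_ge m :: ('n, 'k) mps set) (add_monoid mps_ring)"
  proof (rule mps.add.subgroupI)
    fix f :: "('n, 'k) mps" assume "f \<in> mps_ord_ge m"
    then show "\<ominus>\<^bsub>mps_ring\<^esub> f \<in> mps_ord_ge m"
      by (simp add: mps_ord_ge_def uminus_mps)
  qed (auto simp: mps_ord_ge_def add_mps)
next
  fix f g :: "('n, 'k) mps" assume "f \<in> mps_ord_ge m"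
  then show "g \<otimes>\<^bsub>mps_ring\<^esub> f \<in> mps_ord_ge m" "f \<otimes>\<^bsub>mps_ring\<^esub> g \<in> mps_ord_ge m"
    using mps_ord_ge_mult[of g 0 f m] mps_ord_ge_mult[of f m g 0] by (auto simp: mps_ord_ge_def)
qed

text \<open>
  Completeness: a coefficient of total degree below \<open>m\<close> changes only in those steps \<open>n\<close> with
  \<open>p n < m\<close>, that is, finitely often. The limit takes the eventual coefficients.
\<close>

lemma mps_ord_ge_complete:
  fixes f :: "nat \<Rightarrow> ('n::finite, 'k::field) mps"
  assumes diff: "\<And>n. f n \<ominus>\<^bsub>mps_ring\<^esub> f (Suc n) \<in> mps_ord_ge (p n)"
    and p: "filterlim p at_top sequentially"
  obtains g where "\<And>m. \<forall>\<^sub>F n in sequentially. f n \<ominus>\<^bsub>mps_ring\<^esub> g \<in> mps_ord_ge m"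
proof -
  have stable: "\<exists>N. \<forall>n\<ge>N. \<forall>e. total_degree e < m \<longrightarrow> f n e = f N e" for m
  proof -
    obtain N where N: "\<And>n. n \<ge> N \<Longrightarrow> m \<le> p n"
      using p by (auto simp: filterlim_at_top eventually_sequentially)
    have "f n e = f N e" if "n \<ge> N" "total_degree e < m" for n e
      using that(1)
    proof (induction n rule: dec_induct)
      case (step n)
      then have "total_degree e < p n"
        using N[of n] that(2) by simp
      then show ?case
        using diff[of n] step by (simp add: mps_ord_ge_def minus_mps)
    qed simp
    then show ?thesis by blast
  qed
  then obtain N where N: "\<And>m n e. n \<ge> N m \<Longrightarrow> total_degree e < m \<Longrightarrow> f n e = f (N m) e"
    by metis
  define g where "g e = f (N (Suc (total_degree e))) e" for e
  have "f n \<ominus>\<^bsub>mps_ring\<^esub> g \<in> mps_ord_ge m" if "n \<ge> N m" for m n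
  proof -
    have "f n e = g e" if e: "total_degree e < m" for e
    proof -
      let ?n = "max (N m) (N (Suc (total_degree e)))"
      have "f n e = f ?n e"
        using N[of m n e] N[of m ?n e] \<open>n \<ge> N m\<close> e by simp
      also have "\<dots> = g e"
        using N[of "Suc (total_degree e)" ?n e] by (simp add: g_def)
      finally show ?thesis .
    qed
    then show ?thesis by (simp add: mps_ord_ge_def minus_mps)
  qed
  then show thesis
    by (intro that) (auto simp: eventually_sequentially)
qed

definition mps_X :: "'n \<Rightarrow> ('n::finite, 'k::field) mps" where
  "mps_X j = (\<lambda>e. if e = (\<lambda>i. if i = j then 1 else 0) then 1 else 0)"

lemma mps_X_mult:
  "mps_X j \<otimes>\<^bsub>mps_ring\<^esub> f = (\<lambda>e. if e j = 0 then 0 else f (e(j := e j - 1)))"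
proof
  fix e :: "'a \<Rightarrow> nat"
  let ?u = "\<lambda>i. if i = j then 1 else 0 :: nat"
  have "(mps_X j \<otimes>\<^bsub>mps_ring\<^esub> f) e = (\<Sum>d\<in>{..e}. if d = ?u then f (\<lambda>i. e i - ?u i) else 0)"
    unfolding mult_mps by (intro sum.cong) (auto simp: mps_X_def)
  also have "\<dots> = (if ?u \<le> e then f (\<lambda>i. e i - ?u i) else 0)"
    by (simp add: finite_atMost_nat_fun)
  also have "?u \<le> e \<longleftrightarrow> e j \<noteq> 0"
    by (auto simp: le_fun_def Suc_le_eq)
  also have "(\<lambda>i. e i - ?u i) = e(j := e j - 1)"
    by auto
  finally show "(mps_X j \<otimes>\<^bsub>mps_ring\<^esub> f) e = (if e j = 0 then 0 else f (e(j := e j - 1)))"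
    by simp
qed

text \<open>
  Every exponent \<open>e \<noteq> 0\<close> is assigned one variable \<open>\<phi> e\<close> that occurs in it; the series
  \<open>h j\<close> collects the terms assigned to \<open>j\<close>, divided by \<open>X\<^sub>j\<close>.
\<close>

lemma mps_ord_ge_Suc_decompose:
  fixes f :: "('n::finite, 'k::field) mps"
  assumes f: "f \<in> mps_ord_ge (Suc m)"
  obtains h :: "'n \<Rightarrow> ('n, 'k) mps"
  where "\<And>j. h j \<in> mps_ord_ge m" "f = (\<lambda>e. \<Sum>j\<in>UNIV. (mps_X j \<otimes>\<^bsub>mps_ring\<^esub> h j) e)"
proof -
  define \<phi> where "\<phi> e = (SOME i. e i \<noteq> 0)" for e :: "'n \<Rightarrow> nat"
  have \<phi>: "e (\<phi> e) \<noteq> 0" if "e \<noteq> (\<lambda>_. 0)" for e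
    unfolding \<phi>_def by (rule someI_ex) (use that in auto)
  define h where "h j e = (if \<phi> (e(j := Suc (e j))) = j then f (e(j := Suc (e j))) else 0)"
    for j and e :: "'n \<Rightarrow> nat"
  have tot: "total_degree (e(j := Suc (e j))) = Suc (total_degree e)" for e and j :: 'n
  proof -
    have "total_degree (e(j := Suc (e j))) = Suc (e j) + (\<Sum>i\<in>UNIV - {j}. e i)"
      by (simp add: total_degree_def sum.remove[of UNIV j])
    then show ?thesis
      by (simp add: total_degree_def sum.remove[of UNIV j e])
  qed
  have "h j \<in> mps_ord_ge m" for j
    using f by (simp add: h_def mps_ord_ge_def tot)
  moreover have "f e = (\<Sum>j\<in>UNIV. (mps_X j \<otimes>\<^bsub>mps_ring\<^esub> h j) e)" for e
  proof -
    have "(\<Sum>j\<in>UNIV. (mps_X j \<otimes>\<^bsub>mps_ring\<^esub> h j) e)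
        = (\<Sum>j\<in>UNIV. if j = \<phi> e then (if e j = 0 then 0 else f e) else 0)"
      by (intro sum.cong) (auto simp: mps_X_mult h_def)
    also have "\<dots> = (if e (\<phi> e) = 0 then 0 else f e)"
      by simp
    also have "\<dots> = f e"
      using f \<phi>[of e] total_degree_eq_0_iff[of e] by (auto simp: mps_ord_ge_def)
    finally show ?thesis ..
  qed
  ultimately show thesis
    using that by blast
qed

section \<open>The field of fractions of a domain\<close>

context domain
begin

lemma equiv_frac_rel: "equiv (carrier R \<times> (carrier R - {\<zero>})) (frac_rel R)"
proof (rule equivI)
  show "frac_rel R \<subseteq> (carrier R \<times> (carrier R - {\<zero>})) \<times> (carrier R \<times> (carrier R - {\<zero>}))"
    by (auto simp: frac_rel_def)
  show "refl_on (carrier R \<times> (carrier R - {\<zero>})) (frac_rel R)"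
    by (auto simp: refl_on_def frac_rel_def)
  show "sym (frac_rel R)"
    by (auto simp: sym_def frac_rel_def)
  show "trans (frac_rel R)"
  proof (rule transI)
    fix x y z assume "(x, y) \<in> frac_rel R" "(y, z) \<in> frac_rel R"
    then obtain a b c d e f where
      xyz: "x = (a, b)" "y = (c, d)" "z = (e, f)" and
      in_R: "a \<in> carrier R" "b \<in> carrier R" "c \<in> carrier R" "d \<in> carrier R"
        "e \<in> carrier R" "f \<in> carrier R" and
      nz: "b \<noteq> \<zero>" "d \<noteq> \<zero>" "f \<noteq> \<zero>" and
      eq: "a \<otimes> d = c \<otimes> b" "c \<otimes> f = e \<otimes> d"
      by (auto simp: frac_rel_def)
    have "d \<otimes> (a \<otimes> f) = (a \<otimes> d) \<otimes> f"
      using in_R by algebra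
    also have "\<dots> = (c \<otimes> f) \<otimes> b"
      unfolding eq(1) using in_R by algebra
    also have "\<dots> = d \<otimes> (e \<otimes> b)"
      unfolding eq(2) using in_R by algebra
    finally have "a \<otimes> f = e \<otimes> b"
      using in_R nz m_lcancel by auto
    then show "(x, z) \<in> frac_rel R"
      using xyz in_R nz by (auto simp: frac_rel_def)
  qed
qed

lemma fraction_eq_iff:
  assumes "a \<in> carrier R" "b \<in> carrier R - {\<zero>}" "c \<in> carrier R" "d \<in> carrier R - {\<zero>}"
  shows "fraction R a b = fraction R c d \<longleftrightarrow> a \<otimes> d = c \<otimes> b"
  unfolding fraction_def using assms
  by (subst eq_equiv_class_iff[OF equiv_frac_rel]) (auto simp: frac_rel_def)

lemma fraction_closed:
  "a \<in> carrier R \<Longrightarrow> b \<in> carrier R - {\<zero>} \<Longrightarrow>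
    fraction R a b \<in> carrier (frac_field R)"
  by (auto simp: frac_field_def fraction_def intro!: quotientI)

lemma frac_field_cases:
  assumes "x \<in> carrier (frac_field R)"
  obtains a b where "a \<in> carrier R" "b \<in> carrier R - {\<zero>}" "x = fraction R a b"
  using assms by (auto simp: frac_field_def fraction_def elim!: quotientE)

lemma zero_frac_field: "\<zero>\<^bsub>frac_field R\<^esub> = fraction R \<zero> \<one>"
  and one_frac_field: "\<one>\<^bsub>frac_field R\<^esub> = fraction R \<one> \<one>"
  by (simp_all add: frac_field_def)

lemma mult_fraction:
  assumes "a \<in> carrier R" "b \<in> carrier R - {\<zero>}" "c \<in> carrier R" "d \<in> carrier R - {\<zero>}"
  shows "fraction R a b \<otimes>\<^bsub>frac_field R\<^esub> fraction R c d = fraction R (a \<otimes> c) (b \<otimes> d)"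
proof -
  have "congruent2 (frac_rel R) (frac_rel R)
      (\<lambda>x y. fraction R (fst x \<otimes> fst y) (snd x \<otimes> snd y))"
  proof (rule congruent2I[OF equiv_frac_rel equiv_frac_rel], goal_cases)
    case (1 x y z)
    obtain a b c d e f where xyz: "x = (a, b)" "y = (c, d)" "z = (e, f)"
      by (metis surj_pair)
    with 1 have
      "a \<in> carrier R" "b \<in> carrier R" "c \<in> carrier R" "d \<in> carrier R"
      "e \<in> carrier R" "f \<in> carrier R" "b \<noteq> \<zero>" "d \<noteq> \<zero>" "f \<noteq> \<zero>"
      "a \<otimes> d = c \<otimes> b"
      by (auto simp: frac_rel_def)
    moreover from this xyz have "(a \<otimes> e) \<otimes> (d \<otimes> f) = (c \<otimes> e) \<otimes> (b \<otimes> f)"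
      by (metis m_assoc m_comm m_closed)
    ultimately show ?case
      using xyz by (simp add: fraction_eq_iff integral_iff)
  next
    case (2 x y z)
    obtain a b c d e f where xyz: "x = (a, b)" "y = (c, d)" "z = (e, f)"
      by (metis surj_pair)
    with 2 have
      "a \<in> carrier R" "b \<in> carrier R" "c \<in> carrier R" "d \<in> carrier R"
      "e \<in> carrier R" "f \<in> carrier R" "b \<noteq> \<zero>" "d \<noteq> \<zero>" "f \<noteq> \<zero>"
      "a \<otimes> d = c \<otimes> b"
      by (auto simp: frac_rel_def)
    moreover from this xyz have "(e \<otimes> a) \<otimes> (f \<otimes> d) = (e \<otimes> c) \<otimes> (f \<otimes> b)"
      by (metis m_assoc m_comm m_closed)
    ultimately show ?case
      using xyz by (simp add: fraction_eq_iff integral_iff)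
  qed
  from UN_equiv_class2[OF equiv_frac_rel equiv_frac_rel this, of "(a, b)" "(c, d)"] assms
  show ?thesis
    by (simp add: frac_field_def fraction_def)
qed

lemma add_fraction:
  assumes "a \<in> carrier R" "b \<in> carrier R - {\<zero>}" "c \<in> carrier R" "d \<in> carrier R - {\<zero>}"
  shows "fraction R a b \<oplus>\<^bsub>frac_field R\<^esub> fraction R c d
    = fraction R ((a \<otimes> d) \<oplus> (c \<otimes> b)) (b \<otimes> d)"
proof -
  have "congruent2 (frac_rel R) (frac_rel R)
      (\<lambda>x y. fraction R ((fst x \<otimes> snd y) \<oplus> (fst y \<otimes> snd x)) (snd x \<otimes> snd y))"
  proof (rule congruent2I[OF equiv_frac_rel equiv_frac_rel], goal_cases)
    case (1 x y z)
    obtain a b c d e f where xyz: "x = (a, b)" "y = (c, d)" "z = (e, f)"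
      by (metis surj_pair)
    with 1 have
      in_R: "a \<in> carrier R" "b \<in> carrier R" "c \<in> carrier R" "d \<in> carrier R"
        "e \<in> carrier R" "f \<in> carrier R" and nz: "b \<noteq> \<zero>" "d \<noteq> \<zero>" "f \<noteq> \<zero>" and
      eq: "a \<otimes> d = c \<otimes> b"
      by (auto simp: frac_rel_def)
    have "((a \<otimes> f) \<oplus> (e \<otimes> b)) \<otimes> (d \<otimes> f) = (a \<otimes> d) \<otimes> (f \<otimes> f) \<oplus> e \<otimes> b \<otimes> d \<otimes> f"
      using in_R by algebra
    also have "\<dots> = ((c \<otimes> f) \<oplus> (e \<otimes> d)) \<otimes> (b \<otimes> f)"
      unfolding eq using in_R by algebra
    finally show ?case
      using xyz in_R nz by (simp add: fraction_eq_iff integral_iff)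
  next
    case (2 x y z)
    obtain a b c d e f where xyz: "x = (a, b)" "y = (c, d)" "z = (e, f)"
      by (metis surj_pair)
    with 2 have
      in_R: "a \<in> carrier R" "b \<in> carrier R" "c \<in> carrier R" "d \<in> carrier R"
        "e \<in> carrier R" "f \<in> carrier R" and nz: "b \<noteq> \<zero>" "d \<noteq> \<zero>" "f \<noteq> \<zero>" and
      eq: "a \<otimes> d = c \<otimes> b"
      by (auto simp: frac_rel_def)
    have "((e \<otimes> b) \<oplus> (a \<otimes> f)) \<otimes> (f \<otimes> d) = (a \<otimes> d) \<otimes> (f \<otimes> f) \<oplus> e \<otimes> b \<otimes> d \<otimes> f"
      using in_R by algebra
    also have "\<dots> = ((e \<otimes> d) \<oplus> (c \<otimes> f)) \<otimes> (f \<otimes> b)"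
      unfolding eq using in_R by algebra
    finally show ?case
      using xyz in_R nz by (simp add: fraction_eq_iff integral_iff)
  qed
  from UN_equiv_class2[OF equiv_frac_rel equiv_frac_rel this, of "(a, b)" "(c, d)"] assms
  show ?thesis
    by (simp add: frac_field_def fraction_def)
qed

lemma abelian_monoid_frac_field: "abelian_monoid (frac_field R)"
proof (rule abelian_monoidI)
  fix x y z
  assume x: "x \<in> carrier (frac_field R)" and y: "y \<in> carrier (frac_field R)"
    and z: "z \<in> carrier (frac_field R)"
  obtain a b where x': "a \<in> carrier R" "b \<in> carrier R - {\<zero>}" "x = fraction R a b"
    using x by (rule frac_field_cases)
  obtain c d where y': "c \<in> carrier R" "d \<in> carrier R - {\<zero>}" "y = fraction R c d"
    using y by (rule frac_field_cases)
  obtain e f where z': "e \<in> carrier R" "f \<in> carrier R - {\<zero>}" "z = fraction R e f"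
    using z by (rule frac_field_cases)
  have in_R: "a \<in> carrier R" "b \<in> carrier R" "c \<in> carrier R" "d \<in> carrier R"
      "e \<in> carrier R" "f \<in> carrier R"
    using x' y' z' by auto
  have "((a \<otimes> d \<oplus> c \<otimes> b) \<otimes> f \<oplus> e \<otimes> (b \<otimes> d)) = (a \<otimes> (d \<otimes> f) \<oplus> (c \<otimes> f \<oplus> e \<otimes> d) \<otimes> b)"
    "b \<otimes> d \<otimes> f = b \<otimes> (d \<otimes> f)"
    using in_R by algebra+
  then show "x \<oplus>\<^bsub>frac_field R\<^esub> y \<oplus>\<^bsub>frac_field R\<^esub> z
      = x \<oplus>\<^bsub>frac_field R\<^esub> (y \<oplus>\<^bsub>frac_field R\<^esub> z)"
    using x' y' z' by (simp add: add_fraction integral_iff)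
  show "x \<oplus>\<^bsub>frac_field R\<^esub> y \<in> carrier (frac_field R)"
    using x' y' by (simp add: add_fraction fraction_closed integral_iff)
  show "\<zero>\<^bsub>frac_field R\<^esub> \<oplus>\<^bsub>frac_field R\<^esub> x = x"
    using x' by (simp add: zero_frac_field add_fraction)
  have "a \<otimes> d \<oplus> c \<otimes> b = c \<otimes> b \<oplus> a \<otimes> d" "b \<otimes> d = d \<otimes> b"
    using in_R by algebra+
  then show "x \<oplus>\<^bsub>frac_field R\<^esub> y = y \<oplus>\<^bsub>frac_field R\<^esub> x"
    using x' y' by (simp add: add_fraction)
qed (simp add: zero_frac_field fraction_closed)

lemma fraction_one_eq_zero_iff:
  "a \<in> carrier R \<Longrightarrow> fraction R a \<one> = \<zero>\<^bsub>frac_field R\<^esub> \<longleftrightarrow> a = \<zero>"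
  by (simp add: zero_frac_field fraction_eq_iff)

text \<open>An element \<open>a\<close> of \<open>R\<close> is a root of the monic linear polynomial \<open>X - a\<close>.\<close>

lemma fraction_one_integral:
  assumes a: "a \<in> carrier R"
  shows "fraction R a \<one>
    \<in> integral_closure (frac_field R) ((\<lambda>a. fraction R a \<one>) ` carrier R)"
proof -
  let ?L = "frac_field R"
  interpret L: abelian_monoid ?L
    by (rule abelian_monoid_frac_field)
  have one: "fraction R b \<one> \<otimes>\<^bsub>?L\<^esub> \<one>\<^bsub>?L\<^esub> = fraction R b \<one>"
    "\<one>\<^bsub>?L\<^esub> \<otimes>\<^bsub>?L\<^esub> fraction R b \<one> = fraction R b \<one>" if "b \<in> carrier R" for b
    using that by (simp_all add: one_frac_field mult_fraction)
  let ?c = "\<lambda>_::nat. fraction R (\<ominus> a) \<one>"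
  have "(\<Oplus>\<^bsub>?L\<^esub>i\<in>{..<1::nat}. ?c i \<otimes>\<^bsub>?L\<^esub> (fraction R a \<one> [^]\<^bsub>?L\<^esub> i)) = fraction R (\<ominus> a) \<one>"
    using a one[of "\<ominus> a"] by (simp add: lessThan_Suc nat_pow_def fraction_closed L.finsum_insert)
  moreover have "fraction R a \<one> [^]\<^bsub>?L\<^esub> (1::nat) = fraction R a \<one>"
    using a one by (simp add: nat_pow_def)
  moreover have "fraction R a \<one> \<oplus>\<^bsub>?L\<^esub> fraction R (\<ominus> a) \<one> = \<zero>\<^bsub>?L\<^esub>"
    using a by (simp add: add_fraction zero_frac_field r_neg)
  ultimately show ?thesis
    using a unfolding integral_closure_def
    by (auto simp: fraction_closed intro!: exI[of _ "1::nat"] exI[of _ ?c])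
qed

end

section \<open>The centre of a normalized valuation\<close>

locale valued_domain = domain +
  fixes v :: "('a \<times> 'a) set \<Rightarrow> int"
  assumes normalized: "normalized_valuation (frac_field R)
    (integral_closure (frac_field R) ((\<lambda>a. fraction R a \<one>) ` carrier R)) v"
begin

abbreviation val :: "'a \<Rightarrow> int" where
  "val a \<equiv> v (fraction R a \<one>)"

lemma valuation_add:
  assumes "x \<in> carrier (frac_field R)" "y \<in> carrier (frac_field R)"
    "x \<noteq> \<zero>\<^bsub>frac_field R\<^esub>" "y \<noteq> \<zero>\<^bsub>frac_field R\<^esub>"
    "x \<oplus>\<^bsub>frac_field R\<^esub> y \<noteq> \<zero>\<^bsub>frac_field R\<^esub>"
  shows "min (v x) (v y) \<le> v (x \<oplus>\<^bsub>frac_field R\<^esub> y)"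
  using assms normalized by (simp add: normalized_valuation_def)

lemma val_mult:
  assumes "a \<in> carrier R - {\<zero>}" "b \<in> carrier R - {\<zero>}"
  shows "val (a \<otimes> b) = val a + val b"
proof -
  have "v (fraction R a \<one> \<otimes>\<^bsub>frac_field R\<^esub> fraction R b \<one>) = val a + val b"
    using assms normalized
    by (simp add: normalized_valuation_def fraction_one_eq_zero_iff fraction_closed)
  then show ?thesis
    using assms by (simp add: mult_fraction)
qed

lemma val_add:
  assumes "a \<in> carrier R - {\<zero>}" "b \<in> carrier R - {\<zero>}" "a \<oplus> b \<noteq> \<zero>"
  shows "min (val a) (val b) \<le> val (a \<oplus> b)"
proof -
  have sum: "fraction R a \<one> \<oplus>\<^bsub>frac_field R\<^esub> fraction R b \<one> = fraction R (a \<oplus> b) \<one>"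
    using assms by (simp add: add_fraction)
  then have "min (val a) (val b) \<le> v (fraction R a \<one> \<oplus>\<^bsub>frac_field R\<^esub> fraction R b \<one>)"
    using assms by (intro valuation_add) (simp_all add: fraction_one_eq_zero_iff fraction_closed)
  then show ?thesis
    using sum by simp
qed

text \<open>
  The valuation ring is the integral closure of \<open>R\<close>, so it contains \<open>R\<close>.
\<close>

lemma val_nonneg:
  assumes "a \<in> carrier R - {\<zero>}"
  shows "0 \<le> val a"
proof -
  have "fraction R a \<one> \<in> {x \<in> carrier (frac_field R). x \<noteq> \<zero>\<^bsub>frac_field R\<^esub> \<longrightarrow> 0 \<le> v x}"
    using fraction_one_integral[of a] normalized assms by (simp add: normalized_valuation_def)
  then show ?thesis
    using assms by (simp add: fraction_one_eq_zero_iff)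
qed

lemma val_one: "val \<one> = 0"
  using val_mult[of \<one> \<one>] by simp

lemma val_uminus: "a \<in> carrier R - {\<zero>} \<Longrightarrow> val (\<ominus> a) = val a"
proof -
  assume a: "a \<in> carrier R - {\<zero>}"
  have m: "\<ominus> \<one> \<in> carrier R - {\<zero>}"
    using add.inv_eq_1_iff by auto
  have "val (\<ominus> \<one>) + val (\<ominus> \<one>) = 0"
    using val_mult[OF m m] by (simp add: l_minus val_one)
  then have "val (\<ominus> \<one>) = 0"
    by simp
  then show ?thesis
    using val_mult[OF m a] a by (simp add: l_minus)
qed

text \<open>
  The numerator of a fraction of value one has a larger value than the denominator, which has a
  nonnegative one.
\<close>

lemma ex_val_pos: "\<exists>a \<in> carrier R - {\<zero>}. 0 < val a"
proof -
  have "v ` (carrier (frac_field R) - {\<zero>\<^bsub>frac_field R\<^esub>}) = UNIV"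
    using normalized by (simp add: normalized_valuation_def)
  then have "1 \<in> v ` (carrier (frac_field R) - {\<zero>\<^bsub>frac_field R\<^esub>})"
    by blast
  then obtain x where "1 = v x" "x \<in> carrier (frac_field R) - {\<zero>\<^bsub>frac_field R\<^esub>}"
    by (rule imageE)
  then have x: "x \<in> carrier (frac_field R)" "x \<noteq> \<zero>\<^bsub>frac_field R\<^esub>" "v x = 1"
    by simp_all
  then obtain a b where ab: "a \<in> carrier R" "b \<in> carrier R - {\<zero>}" "x = fraction R a b"
    by (elim frac_field_cases)
  have "a \<noteq> \<zero>"
    using ab x by (auto simp: zero_frac_field fraction_eq_iff)
  have "x \<otimes>\<^bsub>frac_field R\<^esub> fraction R b \<one> = fraction R a \<one>"
    using ab by (simp add: mult_fraction fraction_eq_iff m_assoc integral_iff)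
  moreover have "v (x \<otimes>\<^bsub>frac_field R\<^esub> fraction R b \<one>) = v x + val b"
    using normalized x ab
    by (simp add: normalized_valuation_def fraction_one_eq_zero_iff fraction_closed)
  ultimately have "0 < val a"
    using x val_nonneg[OF ab(2)] by simp
  then show ?thesis
    using ab \<open>a \<noteq> \<zero>\<close> by blast
qed

definition centre :: "'a set" where
  "centre = {a \<in> carrier R. a \<noteq> \<zero> \<longrightarrow> 0 < val a}"

lemma primeideal_centre: "primeideal centre R"
proof (rule primeidealI)
  show "ideal centre R"
  proof (rule idealI[OF ring_axioms])
    show "subgroup centre (add_monoid R)"
    proof (rule add.subgroupI)
      show "\<ominus> a \<in> centre" if "a \<in> centre" for a
        using that val_uminus[of a] by (cases "a = \<zero>") (auto simp: centre_def)
      show "a \<oplus> b \<in> centre" if "a \<in> centre" "b \<in> centre" for a b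
        using that val_add[of a b]
        by (cases "a = \<zero>"; cases "b = \<zero>") (auto simp: centre_def)
    qed (auto simp: centre_def)
    have *: "a \<otimes> b \<in> centre" if "a \<in> centre" "b \<in> carrier R" for a b
      using that val_mult[of a b] val_nonneg[of b] by (auto simp: centre_def integral_iff)
    show "a \<otimes> b \<in> centre" if "a \<in> centre" "b \<in> carrier R" for a b
      using that by (rule *)
    show "b \<otimes> a \<in> centre" if "a \<in> centre" "b \<in> carrier R" for a b
    proof -
      have "b \<otimes> a = a \<otimes> b"
        using that by (simp add: centre_def m_comm)
      then show ?thesis
        using *[OF that] by simp
    qed
  qed
  show "carrier R \<noteq> centre"
  proof -
    have "\<one> \<notin> centre"
      using val_one by (simp add: centre_def)
    then show ?thesis
      using one_closed by metis
  qed
  show "a \<in> centre \<or> b \<in> centre"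
    if "a \<in> carrier R" "b \<in> carrier R" "a \<otimes> b \<in> centre" for a b
    using that val_mult[of a b] val_nonneg[of a] val_nonneg[of b]
    by (auto simp: centre_def integral_iff)
qed (rule is_cring)

end

lemma (in cring) ideal_eq_carrier_if_Unit:
  assumes "ideal J R" "x \<in> J" "x \<in> Units R"
  shows "J = carrier R"
  using ideal.I_r_closed[OF assms(1,2) Units_inv_closed[OF assms(3)]]
    ideal.one_imp_carrier[OF assms(1)] assms(3) by simp

lemma (in cring) local_maximalideal:
  assumes N: "ideal N R" "N \<noteq> carrier R" and units: "carrier R - N \<subseteq> Units R"
  shows "maximalideal N R" and "max_ideal R = N"
proof -
  have sub: "J \<subseteq> N" if "ideal J R" "J \<noteq> carrier R" for J
    using ideal_eq_carrier_if_Unit[OF that(1)] that(2) units ideal.Icarr[OF that(1)] by blast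
  show max: "maximalideal N R"
    using N sub by (intro maximalidealI) auto
  have "J = N" if "maximalideal J R" for J
  proof -
    interpret J: maximalideal J R by fact
    show ?thesis
      using J.I_maximal[OF N(1)] sub[OF J.is_ideal] J.I_notcarr N(2) ideal.Icarr[OF N(1)] by blast
  qed
  with max show "max_ideal R = N"
    unfolding max_ideal_def by (intro the_equality)
qed

lemma krull_dim_ge:
  assumes "\<And>i. i \<le> d \<Longrightarrow> primeideal (p i) R" "\<And>i. i < d \<Longrightarrow> p i \<subset> p (Suc i)"
  shows "enat d \<le> krull_dim R"
  unfolding krull_dim_def using assms by (intro SUP_upper) auto

text \<open>
  The centre is a nonzero prime ideal, and \<open>{0} \<subset> centre \<subset> N\<close> would be a chain of primes of
  length two.
\<close>

lemma (in valued_domain) centre_eq_maximalideal: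
  assumes N: "ideal N R" "N \<noteq> carrier R" and units: "carrier R - N \<subseteq> Units R"
    and dim: "krull_dim R = 1"
  shows "centre = N"
proof (rule ccontr)
  assume neq: "centre \<noteq> N"
  have C: "ideal centre R"
    by (rule primeideal.axioms(1)[OF primeideal_centre])
  have "centre \<subseteq> N"
  proof
    fix x assume x: "x \<in> centre"
    then have "x \<notin> Units R"
      using ideal_eq_carrier_if_Unit[OF C x] primeideal.I_notcarr[OF primeideal_centre] by metis
    then show "x \<in> N"
      using units x unfolding centre_def by blast
  qed
  obtain a where "a \<in> carrier R - {\<zero>}" "0 < val a"
    using ex_val_pos by (rule bexE)
  then have "\<zero> \<in> centre" "a \<in> centre" "a \<noteq> \<zero>"
    by (simp_all add: centre_def)
  then have "{\<zero>} \<subset> centre"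
    by blast
  define p where "p i = (if i = 0 then {\<zero>} else if i = 1 then centre else N)" for i :: nat
  have "primeideal N R"
    by (intro maximalideal_prime local_maximalideal(1) N units)
  then have "enat 2 \<le> krull_dim R"
    using zeroprimeideal primeideal_centre \<open>centre \<subseteq> N\<close> neq \<open>{\<zero>} \<subset> centre\<close>
    by (intro krull_dim_ge[of 2 p]) (auto simp: p_def less_2_cases_iff)
  then show False
    using dim by (simp add: one_enat_def)
qed

section \<open>Valuations on the ring of power series\<close>

locale mps_valuation =
  fixes w :: "('n::finite, 'k::field) mps \<Rightarrow> enat"
  assumes val_mult: "w (f \<otimes>\<^bsub>mps_ring\<^esub> g) = w f + w g"
    and val_add: "min (w f) (w g) \<le> w (f \<oplus>\<^bsub>mps_ring\<^esub> g)"
    and val_one: "w \<one>\<^bsub>mps_ring\<^esub> = 0"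
    and val_pos: "f (\<lambda>_. 0) = 0 \<Longrightarrow> 1 \<le> w f"
begin

lemma val_zero: "w \<zero>\<^bsub>mps_ring\<^esub> = \<infinity>"
proof -
  have "w \<zero>\<^bsub>mps_ring\<^esub> + w \<zero>\<^bsub>mps_ring\<^esub> = w \<zero>\<^bsub>mps_ring\<^esub>"
    using val_mult[of "\<zero>\<^bsub>mps_ring\<^esub>" "\<zero>\<^bsub>mps_ring\<^esub>"] by simp
  moreover have "1 \<le> w \<zero>\<^bsub>mps_ring\<^esub>"
    by (rule val_pos) (simp add: zero_mps)
  ultimately show ?thesis
    by (cases "w \<zero>\<^bsub>mps_ring\<^esub>") (auto simp: one_enat_def)
qed

lemma val_const_mult:
  assumes "c \<noteq> 0"
  shows "w (mps_const c \<otimes>\<^bsub>mps_ring\<^esub> f) = w f"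
proof -
  have "mps_const c \<otimes>\<^bsub>mps_ring\<^esub> mps_const (inverse c) = (\<one>\<^bsub>mps_ring\<^esub> :: ('n, 'k) mps)"
    unfolding mps_const_mult one_mps using assms by (auto simp: mps_const_def)
  then have "w (mps_const c) = 0"
    using val_mult[of "mps_const c" "mps_const (inverse c)"] val_one by simp
  then show ?thesis
    by (simp add: val_mult)
qed

lemma val_minus: "min (w f) (w g) \<le> w (f \<ominus>\<^bsub>mps_ring\<^esub> g)"
proof -
  have "\<ominus>\<^bsub>mps_ring\<^esub> g = mps_const (- 1) \<otimes>\<^bsub>mps_ring\<^esub> g"
    by (simp add: uminus_mps mps_const_mult)
  then have "w (\<ominus>\<^bsub>mps_ring\<^esub> g) = w g"
    by (simp add: val_const_mult)
  then show ?thesis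
    using val_add[of f "\<ominus>\<^bsub>mps_ring\<^esub> g"] by (simp add: mps.minus_eq)
qed

lemma val_eq_if_val_minus_greater:
  assumes "w f < w (f \<ominus>\<^bsub>mps_ring\<^esub> g)"
  shows "w g = w f"
proof -
  have "w f \<le> w g"
    using val_minus[of f "f \<ominus>\<^bsub>mps_ring\<^esub> g"] assms by (simp add: minus_minus_mps)
  moreover have "(f \<ominus>\<^bsub>mps_ring\<^esub> g) \<oplus>\<^bsub>mps_ring\<^esub> g = f"
    by (simp add: minus_mps add_mps)
  then have "min (w (f \<ominus>\<^bsub>mps_ring\<^esub> g)) (w g) \<le> w f"
    using val_add[of "f \<ominus>\<^bsub>mps_ring\<^esub> g" g] by simp
  ultimately show ?thesis
    using assms by (auto simp: min_def split: if_splits)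
qed

lemma val_sum:
  assumes "finite A" "\<And>j. j \<in> A \<Longrightarrow> m \<le> w (f j)"
  shows "m \<le> w (\<lambda>e. \<Sum>j\<in>A. f j e)"
  using assms
proof (induction A rule: finite_induct)
  case empty
  then show ?case
    using val_zero by (simp add: zero_mps)
next
  case (insert j A)
  then show ?case
    using val_add[of "f j" "\<lambda>e. \<Sum>j\<in>A. f j e"]
    by (auto simp: add_mps min_def intro: order_trans split: if_splits)
qed

text \<open>
  Each variable has positive value, and a series of order at least \<open>m + 1\<close> is a combination of
  the variables with coefficients of order at least \<open>m\<close>.
\<close>

lemma val_ge_if_ord_ge: "f \<in> mps_ord_ge m \<Longrightarrow> enat m \<le> w f"
proof (induction m arbitrary: f)
  case 0
  then show ?case by (simp flip: zero_enat_def)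
next
  case (Suc m)
  obtain h where h: "\<And>j. h j \<in> mps_ord_ge m"
    and f: "f = (\<lambda>e. \<Sum>j\<in>UNIV. (mps_X j \<otimes>\<^bsub>mps_ring\<^esub> h j) e)"
    using mps_ord_ge_Suc_decompose[OF Suc.prems] by blast
  have "enat (Suc m) \<le> w (mps_X j \<otimes>\<^bsub>mps_ring\<^esub> h j)" for j
  proof -
    have "1 \<le> w (mps_X j)"
      by (rule val_pos) (auto simp: mps_X_def fun_eq_iff)
    then have "1 + enat m \<le> w (mps_X j) + w (h j)"
      using Suc.IH[OF h] by (rule add_mono)
    then show ?thesis
      by (simp add: val_mult one_enat_def)
  qed
  then show ?case
    unfolding f by (intro val_sum) auto
qed

lemma val_pow: "w (f [^]\<^bsub>mps_ring\<^esub> (a::nat)) = enat a * w f"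
proof (induction a)
  case 0
  then show ?case by (simp add: val_one flip: zero_enat_def)
next
  case (Suc a)
  have "enat (Suc a) * w f = enat a * w f + w f"
    by (metis add.commute distrib_right mult_1 of_nat_Suc of_nat_eq_enat)
  then show ?case
    using Suc by (simp add: val_mult)
qed

end

definition power_product :: "('j \<Rightarrow> ('n::finite, 'k::field) mps) \<Rightarrow> 'j set \<Rightarrow> ('j \<Rightarrow> nat) \<Rightarrow> ('n, 'k) mps"
  where "power_product b J \<alpha> = (\<Otimes>\<^bsub>mps_ring\<^esub>j\<in>J. b j [^]\<^bsub>mps_ring\<^esub> \<alpha> j)"

lemma (in mps_valuation) val_power_product:
  assumes "finite J"
  shows "w (power_product b J \<alpha>) = (\<Sum>j\<in>J. enat (\<alpha> j) * w (b j))"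
  unfolding power_product_def using assms
  by (induction J rule: finite_induct) (simp_all add: val_one val_mult val_pow mps.finprod_insert)

lemma power_product_ord_ge:
  assumes "finite J" "\<And>j. j \<in> J \<Longrightarrow> b j (\<lambda>_. 0) = 0"
  shows "power_product b J \<alpha> \<in> mps_ord_ge (\<Sum>j\<in>J. \<alpha> j)"
  unfolding power_product_def using assms
proof (induction J rule: finite_induct)
  case empty
  then show ?case by (simp add: mps_ord_ge_def)
next
  case (insert j J)
  have "b j [^]\<^bsub>mps_ring\<^esub> \<alpha> j \<in> mps_ord_ge (\<alpha> j * 1)"
    by (rule mps_ord_ge_pow) (use insert.prems in \<open>simp add: mps_ord_ge_1 del: One_nat_def\<close>)
  then show ?case
    using insert mps_ord_ge_mult by (simp add: mps.finprod_insert)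
qed

section \<open>Products dominating a given value\<close>

text \<open>
  The situation of a standard basis, lifted from the coordinate ring of the curve to \<open>K[[X]]\<close>: the
  \<open>w i\<close> are the values on the branches, the \<open>b j\<close> are representatives of the elements of the
  basis. A series is nonzero on the curve iff one of its values is finite.
\<close>

locale standard_basis_series =
  fixes I :: "'i set" and w :: "'i \<Rightarrow> ('n::finite, 'k::field) mps \<Rightarrow> enat"
    and J :: "'j set" and b :: "'j \<Rightarrow> ('n, 'k) mps"
  assumes finite_I: "finite I" and finite_J: "finite J"
    and valuation: "i \<in> I \<Longrightarrow> mps_valuation (w i)"
    and b_0: "j \<in> J \<Longrightarrow> b j (\<lambda>_. 0) = 0"
    and reduction: "i \<in> I \<Longrightarrow> w i f \<noteq> \<infinity> \<Longrightarrow>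
      \<exists>k\<in>I. w k f \<noteq> \<infinity> \<and> (\<exists>c \<alpha> h.
        h = f \<ominus>\<^bsub>mps_ring\<^esub> (mps_const c \<otimes>\<^bsub>mps_ring\<^esub> power_product b J \<alpha>) \<and>
        (\<forall>i\<in>I. w i f \<le> w i h) \<and> w k f < w k h)"
begin

abbreviation prods :: "('j \<Rightarrow> nat) \<Rightarrow> ('n, 'k) mps" where
  "prods \<equiv> power_product b J"

text \<open>
  The constant \<open>D\<close> bounds all finite values of the generators. A generator of value \<open>\<infinity>\<close> has
  exponent zero in a product of finite value, so only finite values contribute.
\<close>

lemma power_product_val_bound:
  obtains D where "\<And>i \<alpha>. i \<in> I \<Longrightarrow> w i (prods \<alpha>) \<noteq> \<infinity> \<Longrightarrow> w i (prods \<alpha>) \<le> enat (D * (\<Sum>j\<in>J. \<alpha> j))"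
proof
  define D where "D = (\<Sum>i\<in>I. \<Sum>j\<in>J. the_enat (w i (b j)))"
  have D: "the_enat (w i (b j)) \<le> D" if "i \<in> I" "j \<in> J" for i j
  proof -
    have "the_enat (w i (b j)) \<le> (\<Sum>j\<in>J. the_enat (w i (b j)))"
      using that finite_J by (intro member_le_sum) auto
    also have "\<dots> \<le> D"
      unfolding D_def using that finite_I by (intro member_le_sum) auto
    finally show ?thesis .
  qed
  fix i \<alpha> assume i: "i \<in> I" and fin: "w i (prods \<alpha>) \<noteq> \<infinity>"
  interpret mps_valuation "w i"
    using i by (rule valuation)
  have eq: "w i (prods \<alpha>) = (\<Sum>j\<in>J. enat (\<alpha> j) * w i (b j))"
    using finite_J by (rule val_power_product)
  have "enat (\<alpha> j) * w i (b j) \<le> enat (D * \<alpha> j)" if j: "j \<in> J" for j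
  proof -
    have "enat (\<alpha> j) * w i (b j) \<noteq> \<infinity>"
    proof
      assume "enat (\<alpha> j) * w i (b j) = \<infinity>"
      moreover have "enat (\<alpha> j) * w i (b j) \<le> w i (prods \<alpha>)"
        unfolding eq using j finite_J by (intro member_le_sum) auto
      ultimately show False
        using fin by simp
    qed
    then show ?thesis
      using mult_right_mono[OF D[OF i j], of "\<alpha> j"]
      by (cases "w i (b j)"; cases "\<alpha> j") (auto simp: zero_enat_def algebra_simps)
  qed
  then have "w i (prods \<alpha>) \<le> (\<Sum>j\<in>J. enat (D * \<alpha> j))"
    unfolding eq by (rule sum_mono)
  also have "\<dots> = enat (D * (\<Sum>j\<in>J. \<alpha> j))"
    by (simp add: sum_distrib_left flip: of_nat_eq_enat)
  finally show "w i (prods \<alpha>) \<le> enat (D * (\<Sum>j\<in>J. \<alpha> j))" .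
qed

text \<open>
  Since the reduction raises the value at \<open>k\<close>, the coefficient of the subtracted product is
  nonzero, hence a unit of value zero, and the product itself cancels the value of \<open>f\<close> at \<open>k\<close>.
\<close>

lemma reduction_step:
  assumes "i \<in> I" "w i f \<noteq> \<infinity>"
  obtains k h \<alpha> where "k \<in> I" "w k f \<noteq> \<infinity>" "w k f < w k h" "\<And>i. i \<in> I \<Longrightarrow> w i f \<le> w i h"
    "w k (prods \<alpha>) = w k f" "\<And>i. i \<in> I \<Longrightarrow> w i f \<le> w i (prods \<alpha>)"
    "f \<ominus>\<^bsub>mps_ring\<^esub> h \<in> mps_ord_ge (\<Sum>j\<in>J. \<alpha> j)" "\<And>i. i \<in> I \<Longrightarrow> w i (f \<ominus>\<^bsub>mps_ring\<^esub> h) = w i (prods \<alpha>)"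
proof -
  obtain k c \<alpha> h where k: "k \<in> I" "w k f \<noteq> \<infinity>" and
    h: "h = f \<ominus>\<^bsub>mps_ring\<^esub> (mps_const c \<otimes>\<^bsub>mps_ring\<^esub> prods \<alpha>)" and
    le: "\<And>i. i \<in> I \<Longrightarrow> w i f \<le> w i h" and less: "w k f < w k h"
    using reduction[OF assms] by blast
  have diff: "f \<ominus>\<^bsub>mps_ring\<^esub> h = mps_const c \<otimes>\<^bsub>mps_ring\<^esub> prods \<alpha>"
    unfolding h by (simp add: minus_mps)
  have "c \<noteq> 0"
    using less unfolding h by (auto simp: mps_const_mult minus_mps)
  then have val: "w i (f \<ominus>\<^bsub>mps_ring\<^esub> h) = w i (prods \<alpha>)" if "i \<in> I" for i
    unfolding diff using mps_valuation.val_const_mult[OF valuation[OF that]] by blast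
  have "w i f \<le> w i (prods \<alpha>)" if "i \<in> I" for i
    using mps_valuation.val_minus[OF valuation[OF that], of f h] le[OF that] val[OF that] by simp
  moreover have "w k (prods \<alpha>) = w k f"
    using mps_valuation.val_eq_if_val_minus_greater[OF valuation[OF k(1)], of f "f \<ominus>\<^bsub>mps_ring\<^esub> h"]
      less val[OF k(1)] by (simp add: minus_mps)
  moreover have "f \<ominus>\<^bsub>mps_ring\<^esub> h \<in> mps_ord_ge (\<Sum>j\<in>J. \<alpha> j)"
    unfolding diff
    by (intro ideal.I_l_closed[OF ideal_mps_ord_ge] power_product_ord_ge finite_J b_0) simp_all
  ultimately show thesis
    using that k le less val by blast
qed

text \<open>
  If no product serves \<open>k\<close>, then the set \<open>S\<close> of all series that dominate \<open>f\<close> and agree with it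
  at \<open>k\<close> is closed under reduction. An infinite chain of reductions within \<open>S\<close> converges to
  some \<open>g\<close> in \<open>S\<close> with fewer finite values than \<open>f\<close>.
\<close>

lemma dominating_power_product:
  assumes k: "k \<in> I"
  shows "w k f \<noteq> \<infinity> \<Longrightarrow> \<exists>\<alpha>. w k (prods \<alpha>) = w k f \<and> (\<forall>i\<in>I. w i f \<le> w i (prods \<alpha>))"
proof (induction "card {i \<in> I. w i f \<noteq> \<infinity>}" arbitrary: f rule: less_induct)
  case less
  show ?case
  proof (rule ccontr)
    assume none: "\<nexists>\<alpha>. w k (prods \<alpha>) = w k f \<and> (\<forall>i\<in>I. w i f \<le> w i (prods \<alpha>))"
    obtain D where D: "\<And>i \<alpha>. i \<in> I \<Longrightarrow> w i (prods \<alpha>) \<noteq> \<infinity> \<Longrightarrow>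
        w i (prods \<alpha>) \<le> enat (D * (\<Sum>j\<in>J. \<alpha> j))"
      using power_product_val_bound by blast
    define S where "S = {h. w k h = w k f \<and> (\<forall>i\<in>I. w i f \<le> w i h)}"
    define step where "step h \<kappa> n h' \<longleftrightarrow> \<kappa> \<in> I \<and> w \<kappa> h \<noteq> \<infinity> \<and> w \<kappa> h < w \<kappa> h' \<and>
        (\<forall>i\<in>I. w i h \<le> w i h') \<and> h \<ominus>\<^bsub>mps_ring\<^esub> h' \<in> mps_ord_ge n \<and> w \<kappa> h \<le> enat (D * n)"
      for h \<kappa> n h'
    have ex_step: "\<exists>h'. h' \<in> S \<and> (\<exists>\<kappa> n. step h \<kappa> n h')" if "h \<in> S" for h
    proof -
      have "w k h \<noteq> \<infinity>"
        using that less.prems by (simp add: S_def)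
      from reduction_step[OF k this] obtain \<kappa> h' \<alpha> where
        red: "\<kappa> \<in> I" "w \<kappa> h \<noteq> \<infinity>" "w \<kappa> h < w \<kappa> h'" "\<And>i. i \<in> I \<Longrightarrow> w i h \<le> w i h'"
          "w \<kappa> (prods \<alpha>) = w \<kappa> h" "\<And>i. i \<in> I \<Longrightarrow> w i h \<le> w i (prods \<alpha>)"
          "h \<ominus>\<^bsub>mps_ring\<^esub> h' \<in> mps_ord_ge (\<Sum>j\<in>J. \<alpha> j)"
          "\<And>i. i \<in> I \<Longrightarrow> w i (h \<ominus>\<^bsub>mps_ring\<^esub> h') = w i (prods \<alpha>)"
        by blast
      have le: "w i f \<le> w i (prods \<alpha>)" if "i \<in> I" for i
        using red(6)[OF that] \<open>h \<in> S\<close> that by (auto simp: S_def intro: order_trans)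
      then have "w k (prods \<alpha>) \<noteq> w k f"
        using none by blast
      then have "w k h < w k (h \<ominus>\<^bsub>mps_ring\<^esub> h')"
        using le[OF k] red(8)[OF k] \<open>h \<in> S\<close> by (simp add: S_def)
      then have "w k h' = w k h"
        using mps_valuation.val_eq_if_val_minus_greater[OF valuation[OF k]] by blast
      moreover have "w \<kappa> h \<le> enat (D * (\<Sum>j\<in>J. \<alpha> j))"
        using D[OF red(1), of \<alpha>] red(2,5) by simp
      ultimately have "h' \<in> S" "step h \<kappa> (\<Sum>j\<in>J. \<alpha> j) h'"
        using red \<open>h \<in> S\<close> by (auto simp: S_def step_def intro: order_trans)
      then show ?thesis by blast
    qed
    have "\<exists>F. \<forall>n. F n \<in> S \<and> (\<exists>\<kappa> m. step (F n) \<kappa> m (F (Suc n)))"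
    proof (rule dependent_nat_choice)
      show "\<exists>h. h \<in> S"
        by (rule exI[of _ f]) (simp add: S_def)
    qed (use ex_step in blast)
    then obtain F \<kappa> m where F_S: "\<And>n. F n \<in> S"
      and step: "\<And>n. step (F n) (\<kappa> n) (m n) (F (Suc n))"
      by metis
    have \<kappa>_I: "\<kappa> n \<in> I" and \<kappa>_fin: "w (\<kappa> n) (F n) \<noteq> \<infinity>"
      and \<kappa>_less: "w (\<kappa> n) (F n) < w (\<kappa> n) (F (Suc n))"
      and F_le: "\<And>i. i \<in> I \<Longrightarrow> w i (F n) \<le> w i (F (Suc n))"
      and F_diff: "F n \<ominus>\<^bsub>mps_ring\<^esub> F (Suc n) \<in> mps_ord_ge (m n)"
      and m_ge: "w (\<kappa> n) (F n) \<le> enat (D * m n)" for n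
      using step[of n] unfolding step_def by blast+
    have mono: "w i (F n) \<le> w i (F n')" if "i \<in> I" "n \<le> n'" for i n n'
      using F_le[OF that(1)] that(2) by (rule lift_Suc_mono_le[of "\<lambda>n. w i (F n)"])
    \<comment> \<open>At each branch the values strictly increase along the steps that reduce it, so the pair of
      branch and value determines the step.\<close>
    have fin: "finite {n. w (\<kappa> n) (F n) \<le> enat M}" for M
    proof (rule finite_imageD)
      have "finite {..enat M}"
        by (rule finite_enat_bounded) auto
      then have "finite (I \<times> {..enat M})"
        by (rule finite_cartesian_product[OF finite_I])
      moreover have "(\<lambda>n. (\<kappa> n, w (\<kappa> n) (F n))) ` {n. w (\<kappa> n) (F n) \<le> enat M} \<subseteq> I \<times> {..enat M}"
        using \<kappa>_I by blast
      ultimately show "finite ((\<lambda>n. (\<kappa> n, w (\<kappa> n) (F n))) ` {n. w (\<kappa> n) (F n) \<le> enat M})"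
        by (rule rev_finite_subset)
      have less: "w (\<kappa> n) (F n) < w (\<kappa> n) (F n')" if "n < n'" for n n'
        using \<kappa>_less[of n] mono[OF \<kappa>_I, of "Suc n" n' n] that by simp
      show "inj_on (\<lambda>n. (\<kappa> n, w (\<kappa> n) (F n))) {n. w (\<kappa> n) (F n) \<le> enat M}"
      proof (rule linorder_inj_onI)
        fix n n' :: nat assume "n < n'"
        then show "(\<kappa> n, w (\<kappa> n) (F n)) \<noteq> (\<kappa> n', w (\<kappa> n') (F n'))"
          using less[of n n'] by auto
      qed auto
    qed
    have "filterlim m at_top sequentially"
      unfolding filterlim_at_top
    proof
      fix M
      have "\<forall>\<^sub>F n in sequentially. \<not> w (\<kappa> n) (F n) \<le> enat (D * M)"
        using fin[of "D * M"] by (simp add: eventually_cofinite flip: cofinite_eq_sequentially)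
      then show "\<forall>\<^sub>F n in sequentially. M \<le> m n"
      proof eventually_elim
        case (elim n)
        then have "enat (D * M) < enat (D * m n)"
          unfolding not_le using m_ge[of n] by (rule less_le_trans)
        then show ?case by simp
      qed
    qed
    then obtain g where g: "\<And>l. \<forall>\<^sub>F n in sequentially. F n \<ominus>\<^bsub>mps_ring\<^esub> g \<in> mps_ord_ge l"
      using mps_ord_ge_complete[of F m, OF F_diff] by blast
    have close: "\<exists>n\<ge>N. F n \<ominus>\<^bsub>mps_ring\<^esub> g \<in> mps_ord_ge l" for l N
      using g[of l] unfolding eventually_sequentially by (meson nle_le)
    \<comment> \<open>The remainder \<open>F n - g\<close> has arbitrarily large value for late \<open>n\<close>, so a value of \<open>g\<close> below
      that of the \<open>F n\<close> would contradict the ultrametric inequality.\<close>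
    have F_le_g: "w i (F n) \<le> w i g" if i: "i \<in> I" for i n
    proof (rule ccontr)
      interpret mps_valuation "w i"
        using i by (rule valuation)
      assume "\<not> w i (F n) \<le> w i g"
      then obtain q where q: "w i g = enat q" "enat q < w i (F n)"
        by (cases "w i g") auto
      obtain n' where n': "n' \<ge> n" "F n' \<ominus>\<^bsub>mps_ring\<^esub> g \<in> mps_ord_ge (Suc q)"
        using close by blast
      have "min (w i (F n')) (w i (F n' \<ominus>\<^bsub>mps_ring\<^esub> g)) \<le> w i g"
        using val_minus[of "F n'" "F n' \<ominus>\<^bsub>mps_ring\<^esub> g"] by (simp add: minus_minus_mps)
      moreover have "enat q < w i (F n')"
        using q mono[OF i n'(1)] by simp
      moreover have "enat (Suc q) \<le> w i (F n' \<ominus>\<^bsub>mps_ring\<^esub> g)"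
        using n'(2) by (rule val_ge_if_ord_ge)
      then have "enat q < w i (F n' \<ominus>\<^bsub>mps_ring\<^esub> g)"
        by (simp add: Suc_ile_eq)
      ultimately show False
        using q(1) by (auto simp: min_def split: if_splits)
    qed
    have f_le_g: "w i f \<le> w i g" if "i \<in> I" for i
      using F_le_g[OF that, of 0] F_S[of 0] that by (auto simp: S_def intro: order_trans)
    have g_k: "w k g = w k f"
    proof -
      interpret mps_valuation "w k"
        using k by (rule valuation)
      obtain a where a: "w k f = enat a"
        using less.prems by auto
      obtain n where "F n \<ominus>\<^bsub>mps_ring\<^esub> g \<in> mps_ord_ge (Suc a)"
        using close by blast
      then have "enat (Suc a) \<le> w k (F n \<ominus>\<^bsub>mps_ring\<^esub> g)"
        by (rule val_ge_if_ord_ge)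
      moreover have "w k (F n) = enat a"
        using F_S[of n] a by (simp add: S_def)
      ultimately show ?thesis
        using val_eq_if_val_minus_greater[of "F n" g] a by (simp add: Suc_ile_eq)
    qed
    \<comment> \<open>A branch that is reduced infinitely often gains a new infinite value in the limit.\<close>
    obtain i where i: "i \<in> I" "w i f \<noteq> \<infinity>" "w i g = \<infinity>"
    proof -
      have "finite (\<kappa> ` UNIV)"
        using finite_subset[OF _ finite_I, of "\<kappa> ` UNIV"] \<kappa>_I by blast
      then obtain n where inf: "infinite {n'. \<kappa> n' = \<kappa> n}"
        using pigeonhole_infinite[of UNIV \<kappa>] by auto
      have "\<kappa> n \<in> I" "w (\<kappa> n) (F n) \<noteq> \<infinity>"
        by (rule \<kappa>_I, rule \<kappa>_fin)
      moreover have "w (\<kappa> n) f \<le> w (\<kappa> n) (F n)"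
        using F_S[of n] \<open>\<kappa> n \<in> I\<close> by (simp add: S_def)
      moreover have "w (\<kappa> n) g = \<infinity>"
      proof (rule ccontr)
        assume "w (\<kappa> n) g \<noteq> \<infinity>"
        then obtain M where "w (\<kappa> n) g = enat M"
          by auto
        then have "{n'. \<kappa> n' = \<kappa> n} \<subseteq> {n. w (\<kappa> n) (F n) \<le> enat M}"
          using F_le_g[OF \<open>\<kappa> n \<in> I\<close>] by auto
        then show False
          using inf fin finite_subset by blast
      qed
      ultimately show thesis
        using that[of "\<kappa> n"] by (cases "w (\<kappa> n) f") auto
    qed
    have "{i \<in> I. w i g \<noteq> \<infinity>} \<subset> {i \<in> I. w i f \<noteq> \<infinity>}"
    proof
      show "{i \<in> I. w i g \<noteq> \<infinity>} \<subseteq> {i \<in> I. w i f \<noteq> \<infinity>}"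
      proof
        fix i assume "i \<in> {i \<in> I. w i g \<noteq> \<infinity>}"
        then show "i \<in> {i \<in> I. w i f \<noteq> \<infinity>}"
          using f_le_g[of i] by (cases "w i f") auto
      qed
      have "i \<in> {i \<in> I. w i f \<noteq> \<infinity>}" "i \<notin> {i \<in> I. w i g \<noteq> \<infinity>}"
        using i by auto
      then show "{i \<in> I. w i g \<noteq> \<infinity>} \<noteq> {i \<in> I. w i f \<noteq> \<infinity>}"
        by blast
    qed
    then have "card {i \<in> I. w i g \<noteq> \<infinity>} < card {i \<in> I. w i f \<noteq> \<infinity>}"
      using finite_I by (intro psubset_card_mono) auto
    moreover have "w k g \<noteq> \<infinity>"
      using g_k less.prems by simp
    ultimately obtain \<alpha> where "w k (prods \<alpha>) = w k g" "\<forall>i\<in>I. w i g \<le> w i (prods \<alpha>)"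
      using less.hyps by blast
    then show False
      using none g_k f_le_g by (metis order_trans)
  qed
qed

end

section \<open>Values on an algebroid curve\<close>

lemma carrier_curve_ring: "carrier (curve_ring Q) = range ((+>\<^bsub>mps_ring\<^esub>) Q)"
  by (auto simp: FactRing_def A_RCOSETS_def')

lemma sum_enat_eq_infinity_iff:
  fixes f :: "'a \<Rightarrow> enat"
  assumes "finite A"
  shows "sum f A = \<infinity> \<longleftrightarrow> (\<exists>a\<in>A. f a = \<infinity>)"
  using assms by (induction A rule: finite_induct) (auto simp: plus_eq_infty_iff_enat)

text \<open>
  A proper quotient of \<open>K[[X]]\<close> inherits its local structure: the classes of the series without
  constant term form a proper ideal, and all other classes are units.
\<close>

lemma mps_quotient_local:
  assumes Q: "ideal Q mps_ring" "Q \<noteq> UNIV"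
  shows "ideal ((+>\<^bsub>mps_ring\<^esub>) Q ` mps_ord_ge 1) (curve_ring Q)" (is "ideal ?N ?A")
    and "(+>\<^bsub>mps_ring\<^esub>) Q ` mps_ord_ge 1 \<noteq> carrier (curve_ring Q)"
    and "carrier (curve_ring Q) - (+>\<^bsub>mps_ring\<^esub>) Q ` mps_ord_ge 1 \<subseteq> Units (curve_ring Q)"
proof -
  interpret Q: ideal Q mps_ring by fact
  interpret hom: ring_hom_cring mps_ring ?A "(+>\<^bsub>mps_ring\<^esub>) Q"
    by (rule Q.rcos_ring_hom_cring[OF mps.is_cring])
  show "ideal ?N ?A"
    by (rule mps.ring_ideal_imp_quot_ideal[OF Q(1) ideal_mps_ord_ge])
  show "?N \<noteq> carrier ?A"
  proof
    assume "?N = carrier ?A"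
    then obtain f where f: "f \<in> mps_ord_ge 1" "Q +>\<^bsub>mps_ring\<^esub> \<one>\<^bsub>mps_ring\<^esub> = Q +>\<^bsub>mps_ring\<^esub> f"
      using hom.S.one_closed by (metis hom.hom_one imageE)
    then have "\<one>\<^bsub>mps_ring\<^esub> \<ominus>\<^bsub>mps_ring\<^esub> f \<in> Q"
      by (simp add: mps.quotient_eq_iff_same_a_r_cos[OF Q(1)])
    moreover have "\<one>\<^bsub>mps_ring\<^esub> \<ominus>\<^bsub>mps_ring\<^esub> f \<in> Units mps_ring"
      using f(1) by (simp add: Units_mps_iff minus_mps one_mps mps_const_def mps_ord_ge_1 del: One_nat_def)
    ultimately show False
      using mps.ideal_eq_carrier_if_Unit[OF Q(1)] Q(2) by simp
  qed
  show "carrier ?A - ?N \<subseteq> Units ?A"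
  proof
    fix x assume x: "x \<in> carrier ?A - ?N"
    then obtain f where f: "x = Q +>\<^bsub>mps_ring\<^esub> f"
      unfolding carrier_curve_ring by blast
    then have "f \<in> Units mps_ring"
      using x by (auto simp: Units_mps_iff mps_ord_ge_1 simp del: One_nat_def)
    then obtain g where "g \<otimes>\<^bsub>mps_ring\<^esub> f = \<one>\<^bsub>mps_ring\<^esub>" "f \<otimes>\<^bsub>mps_ring\<^esub> g = \<one>\<^bsub>mps_ring\<^esub>"
      by (auto simp: Units_def)
    then have "(Q +>\<^bsub>mps_ring\<^esub> g) \<otimes>\<^bsub>?A\<^esub> x = \<one>\<^bsub>?A\<^esub>" "x \<otimes>\<^bsub>?A\<^esub> (Q +>\<^bsub>mps_ring\<^esub> g) = \<one>\<^bsub>?A\<^esub>"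
      unfolding f by (simp_all flip: hom.hom_mult)
    moreover have "Q +>\<^bsub>mps_ring\<^esub> g \<in> carrier ?A"
      by simp
    ultimately show "x \<in> Units ?A"
      using x by (auto simp: Units_def)
  qed
qed

lemma max_ideal_curve_ring_lift:
  assumes Q: "ideal Q mps_ring" "Q \<noteq> UNIV" and g: "g \<in> max_ideal (curve_ring Q)"
  shows "\<exists>f. f (\<lambda>_. 0) = 0 \<and> Q +>\<^bsub>mps_ring\<^esub> f = g"
proof -
  have "max_ideal (curve_ring Q) = (+>\<^bsub>mps_ring\<^esub>) Q ` mps_ord_ge 1"
    by (rule cring.local_maximalideal(2)[OF ideal.quotient_is_cring[OF Q(1) mps.is_cring]
          mps_quotient_local[OF Q]])
  with g have "g \<in> (+>\<^bsub>mps_ring\<^esub>) Q ` mps_ord_ge 1"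
    by (rule subst[rotated])
  then obtain f where "g = Q +>\<^bsub>mps_ring\<^esub> f" "f \<in> mps_ord_ge 1"
    by (rule imageE)
  then show ?thesis
    by (intro exI[of _ f]) (simp add: mps_ord_ge_1 del: One_nat_def)
qed

text \<open>
  The value of a series on the branch \<open>p\<close>, independent of the curve that contains the branch.
\<close>

definition series_value ::
    "('n::finite, 'k::field) mps set \<Rightarrow>
     ((('n, 'k) mps set \<times> ('n, 'k) mps set) set \<Rightarrow> int) \<Rightarrow> ('n, 'k) mps \<Rightarrow> enat" where
  "series_value p v f =
     (if f \<in> p then \<infinity>
      else enat (nat (v (fraction (curve_ring p) (p +>\<^bsub>mps_ring\<^esub> f) \<one>\<^bsub>curve_ring p\<^esub>))))"

lemma coset_eq_zero_iff:
  assumes "ideal p mps_ring"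
  shows "p +>\<^bsub>mps_ring\<^esub> f = \<zero>\<^bsub>curve_ring p\<^esub> \<longleftrightarrow> f \<in> p"
proof -
  interpret ideal p mps_ring by fact
  show ?thesis
    using rcos_const_imp_mem a_rcos_const by (auto simp: FactRing_def)
qed

lemma branch_value_coset:
  assumes Q: "ideal Q mps_ring" and p: "ideal p mps_ring" and sub: "Q \<subseteq> p"
  shows "branch_value p v (Q +>\<^bsub>mps_ring\<^esub> f) = series_value p v f"
proof -
  interpret Q: ideal Q mps_ring by fact
  interpret p: ideal p mps_ring by fact
  have "p <+>\<^bsub>mps_ring\<^esub> (Q +>\<^bsub>mps_ring\<^esub> f) = p +>\<^bsub>mps_ring\<^esub> f"
  proof
    show "p <+>\<^bsub>mps_ring\<^esub> (Q +>\<^bsub>mps_ring\<^esub> f) \<subseteq> p +>\<^bsub>mps_ring\<^esub> f"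
    proof
      fix x assume "x \<in> p <+>\<^bsub>mps_ring\<^esub> (Q +>\<^bsub>mps_ring\<^esub> f)"
      then obtain a q where aq: "a \<in> p" "q \<in> Q" "x = a \<oplus>\<^bsub>mps_ring\<^esub> (q \<oplus>\<^bsub>mps_ring\<^esub> f)"
        by (auto simp: set_add_def' a_r_coset_def')
      then have "x = (a \<oplus>\<^bsub>mps_ring\<^esub> q) \<oplus>\<^bsub>mps_ring\<^esub> f"
        by (simp add: mps.a_assoc)
      moreover have "a \<oplus>\<^bsub>mps_ring\<^esub> q \<in> p"
        using aq sub by blast
      ultimately show "x \<in> p +>\<^bsub>mps_ring\<^esub> f"
        by (auto simp: a_r_coset_def')
    qed
    show "p +>\<^bsub>mps_ring\<^esub> f \<subseteq> p <+>\<^bsub>mps_ring\<^esub> (Q +>\<^bsub>mps_ring\<^esub> f)"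
    proof
      fix x assume "x \<in> p +>\<^bsub>mps_ring\<^esub> f"
      then obtain a where "a \<in> p" "x = a \<oplus>\<^bsub>mps_ring\<^esub> f"
        by (auto simp: a_r_coset_def')
      then show "x \<in> p <+>\<^bsub>mps_ring\<^esub> (Q +>\<^bsub>mps_ring\<^esub> f)"
        using Q.a_rcos_self[of f] by (auto simp: set_add_def')
    qed
  qed
  then show ?thesis
    by (simp add: branch_value_def series_value_def coset_eq_zero_iff[OF p] Let_def)
qed

lemma mps_valuation_series_value:
  assumes p: "primeideal p mps_ring" and dim: "krull_dim (curve_ring p) = 1"
    and v: "branch_valuation p v"
  shows "mps_valuation (series_value p v)"
proof -
  interpret p: primeideal p mps_ring by fact
  let ?A = "curve_ring p"
  interpret A: domain ?A
    by (rule p.quotient_is_domain)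
  interpret A: valued_domain ?A v
    using v by unfold_locales (simp add: branch_valuation_def Let_def)
  interpret hom: ring_hom_cring mps_ring ?A "(+>\<^bsub>mps_ring\<^esub>) p"
    by (rule p.rcos_ring_hom_cring)
  let ?c = "\<lambda>f. p +>\<^bsub>mps_ring\<^esub> f"
  have zero: "?c f = \<zero>\<^bsub>?A\<^esub> \<longleftrightarrow> f \<in> p" for f
    by (rule coset_eq_zero_iff[OF p.is_ideal])
  have proper: "p \<noteq> UNIV"
    using p.I_notcarr by auto
  have closed: "?c f \<in> carrier ?A - {\<zero>\<^bsub>?A\<^esub>}" if "f \<notin> p" for f
    using that zero[of f] by simp
  show ?thesis
  proof
    fix f g :: "('a, 'b) mps"
    show "series_value p v (f \<otimes>\<^bsub>mps_ring\<^esub> g) = series_value p v f + series_value p v g"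
    proof (cases "f \<in> p \<or> g \<in> p")
      case True
      then have "f \<otimes>\<^bsub>mps_ring\<^esub> g \<in> p"
        using p.I_l_closed p.I_r_closed by auto
      then show ?thesis
        using True by (auto simp: series_value_def)
    next
      case False
      then have "f \<otimes>\<^bsub>mps_ring\<^esub> g \<notin> p"
        using p.I_prime by auto
      then show ?thesis
        using False A.val_mult[of "?c f" "?c g"] A.val_nonneg[of "?c f"] A.val_nonneg[of "?c g"]
          closed[of f] closed[of g]
        by (simp add: series_value_def nat_add_distrib)
    qed
    show "min (series_value p v f) (series_value p v g) \<le> series_value p v (f \<oplus>\<^bsub>mps_ring\<^esub> g)"
    proof (cases "f \<oplus>\<^bsub>mps_ring\<^esub> g \<in> p")
      case True
      then show ?thesis by (simp add: series_value_def)
    next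
      case False
      then have sum: "?c f \<oplus>\<^bsub>?A\<^esub> ?c g \<noteq> \<zero>\<^bsub>?A\<^esub>"
        using zero[of "f \<oplus>\<^bsub>mps_ring\<^esub> g"] by simp
      consider "f \<in> p" | "g \<in> p" | "f \<notin> p" "g \<notin> p" by blast
      then show ?thesis
      proof cases
        case 1
        then have "?c (f \<oplus>\<^bsub>mps_ring\<^esub> g) = ?c g" "g \<notin> p"
          using False zero[of f] by (auto simp: p.a_closed)
        then show ?thesis
          using 1 False by (simp add: series_value_def)
      next
        case 2
        then have "?c (f \<oplus>\<^bsub>mps_ring\<^esub> g) = ?c f" "f \<notin> p"
          using False zero[of g] by (auto simp: p.a_closed)
        then show ?thesis
          using 2 False by (simp add: series_value_def)
      next
        case 3
        then show ?thesis
          using False sum A.val_add[of "?c f" "?c g"] closed[of f] closed[of g]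
          by (auto simp: series_value_def min_def split: if_splits)
      qed
    qed
    show "series_value p v \<one>\<^bsub>mps_ring\<^esub> = 0"
      using p.one_imp_carrier p.I_notcarr A.val_one
      by (auto simp: series_value_def zero_enat_def)
    show "1 \<le> series_value p v f" if "f (\<lambda>_. 0) = 0"
    proof (cases "f \<in> p")
      case False
      have "?c f \<in> (+>\<^bsub>mps_ring\<^esub>) p ` mps_ord_ge 1"
        using that by (auto simp: mps_ord_ge_1 simp del: One_nat_def)
      then have "?c f \<in> A.centre"
        using A.centre_eq_maximalideal[OF mps_quotient_local[OF p.is_ideal proper] dim] by simp
      then have "0 < A.val (?c f)"
        using zero False by (simp add: A.centre_def)
      then show ?thesis
        using False by (simp add: series_value_def one_enat_def)
    qed (simp add: series_value_def)
  qed
qed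

section \<open>Generation of the semiring of values\<close>

theorem theorem11:
  fixes Q :: "('n::finite, 'k::alg_closed_field) mps set"
    and r :: nat
    and P :: "nat \<Rightarrow> ('n, 'k) mps set"
    and v :: "nat \<Rightarrow> (('n, 'k) mps set \<times> ('n, 'k) mps set) set \<Rightarrow> int"
    and G :: "('n, 'k) mps set set"
  assumes "CARD('n) > 1"
    and "algebroid_curve Q r P"
    and "r \<ge> 2"
    and "nondegenerate Q"
    and "\<And>i. i \<in> {1..r} \<Longrightarrow> branch_valuation (P i) (v i)"
    and "standard_basis Q r P v G"
  shows "semiring_generated r (value_semiring Q r P v) (value_vector r P v ` G)"
proof -
  let ?A = "curve_ring Q" and ?I = "{1..r}"
  have Q: "ideal Q mps_ring" "Q \<noteq> UNIV" and inj: "inj_on P ?I"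
    and min: "P ` ?I = minimal_primes mps_ring Q" and Q_eq: "Q = (\<Inter>i\<in>?I. P i)"
    and dim: "\<And>i. i \<in> ?I \<Longrightarrow> krull_dim (curve_ring (P i)) = 1"
    using assms(2) unfolding algebroid_curve_def carrier_mps by blast+
  have min_P: "P i \<in> minimal_primes mps_ring Q" if "i \<in> ?I" for i
    using that min by blast
  then have prime: "primeideal (P i) mps_ring" and sub: "Q \<subseteq> P i" if "i \<in> ?I" for i
    using that by (simp_all add: minimal_primes_def)
  interpret Q: ideal Q mps_ring by fact
  interpret A: cring ?A
    by (rule Q.quotient_is_cring[OF mps.is_cring])
  interpret hom: ring_hom_cring mps_ring ?A "(+>\<^bsub>mps_ring\<^esub>) Q"
    by (rule Q.rcos_ring_hom_cring[OF mps.is_cring])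
  let ?c = "\<lambda>f. Q +>\<^bsub>mps_ring\<^esub> f"
  define w where "w i = series_value (P i) (v i)" for i
  have w: "mps_valuation (w i)" if "i \<in> ?I" for i
    unfolding w_def by (rule mps_valuation_series_value[OF prime[OF that] dim[OF that] assms(5)[OF that]])
  have w_infinity: "w i f = \<infinity> \<longleftrightarrow> f \<in> P i" for i f
    by (simp add: w_def series_value_def)
  have value_coset: "value_vector r P v (?c f) i = w i f" if "i \<in> ?I" for f i
    using that branch_value_coset[OF Q(1) primeideal.axioms(1)[OF prime] sub]
    by (simp add: value_vector_def w_def)

  have G: "finite G" "G \<subseteq> max_ideal ?A" and red: "\<And>g. g \<in> carrier ?A - {\<zero>\<^bsub>?A\<^esub>} \<Longrightarrow>
      \<exists>k\<in>{i \<in> ?I. value_vector r P v g i \<noteq> \<infinity>}. \<exists>h. k_reduction Q r P v G k g h"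
    using assms(6) unfolding standard_basis_def by blast+
  define b where "b g = (SOME f. f (\<lambda>_. 0) = 0 \<and> ?c f = g)" for g
  have "b g (\<lambda>_. 0) = 0 \<and> ?c (b g) = g" if "g \<in> G" for g
    unfolding b_def using max_ideal_curve_ring_lift[OF Q subsetD[OF G(2) that]] by (rule someI_ex)
  then have b: "b g (\<lambda>_. 0) = 0" "?c (b g) = g" if "g \<in> G" for g
    using that by simp_all
  have G_closed: "g \<in> carrier ?A" if "g \<in> G" for g
    using hom.hom_closed[of "b g"] b(2)[OF that] by simp
  have value_G: "value_vector r P v g i = w i (b g)" if "i \<in> ?I" "g \<in> G" for g i
    using value_coset[OF that(1), of "b g"] b(2)[OF that(2)] by simp
  have G_product: "G_product Q G \<alpha> = ?c (power_product b G \<alpha>)" for \<alpha>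
  proof -
    have "?c (power_product b G \<alpha>) = (\<Otimes>\<^bsub>?A\<^esub>g\<in>G. ?c (b g [^]\<^bsub>mps_ring\<^esub> \<alpha> g))"
      unfolding power_product_def by (subst hom.hom_finprod) (auto simp: o_def)
    also have "\<dots> = G_product Q G \<alpha>"
      unfolding G_product_def
      by (intro A.finprod_cong') (auto simp: G_closed b(2) ring_hom_ring.hom_nat_pow[OF Q.rcos_ring_hom_ring])
    finally show ?thesis ..
  qed
  interpret standard_basis_series ?I w G b
  proof (rule standard_basis_series.intro)
    show "finite ?I"
      by simp
    show "finite G"
      by (rule G(1))
    show "mps_valuation (w i)" if "i \<in> ?I" for i
      using that by (rule w)
    show "b g (\<lambda>_. 0) = 0" if "g \<in> G" for g
      using that by (rule b(1))
    fix i f assume i: "i \<in> ?I" "w i f \<noteq> \<infinity>"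
    then have "f \<notin> P i"
      by (simp only: w_infinity not_False_eq_True)
    then have "f \<notin> Q"
      using sub[OF i(1)] by (rule contra_subsetD[rotated])
    then have "?c f \<in> carrier ?A - {\<zero>\<^bsub>?A\<^esub>}"
      by (simp add: coset_eq_zero_iff[OF Q(1)])
    from red[OF this] obtain k h where k: "k \<in> ?I" "w k f \<noteq> \<infinity>" and
      "k_reduction Q r P v G k (?c f) h"
      using value_coset by auto
    then obtain c \<alpha> where h: "h = ?c f \<ominus>\<^bsub>?A\<^esub> (scalar Q c \<otimes>\<^bsub>?A\<^esub> G_product Q G \<alpha>)" and
      le: "\<forall>i\<in>?I. value_vector r P v (?c f) i \<le> value_vector r P v h i" and
      less: "value_vector r P v (?c f) k < value_vector r P v h k"
      unfolding k_reduction_def by blast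
    let ?h = "f \<ominus>\<^bsub>mps_ring\<^esub> (mps_const c \<otimes>\<^bsub>mps_ring\<^esub> power_product b G \<alpha>)"
    have h_lift: "h = ?c ?h"
      unfolding h G_product scalar_def by (simp add: a_minus_def)
    have "w i f \<le> w i ?h" if "i \<in> ?I" for i
      using bspec[OF le that] unfolding h_lift value_coset[OF that] .
    moreover have "w k f < w k ?h"
      using less unfolding h_lift value_coset[OF k(1)] .
    ultimately show "\<exists>k\<in>?I. w k f \<noteq> \<infinity> \<and> (\<exists>c \<alpha> h.
        h = f \<ominus>\<^bsub>mps_ring\<^esub> (mps_const c \<otimes>\<^bsub>mps_ring\<^esub> power_product b G \<alpha>) \<and>
        (\<forall>i\<in>?I. w i f \<le> w i h) \<and> w k f < w k h)"
      using k by blast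
  qed

  have val_prods: "w i (prods \<alpha>) = (\<Sum>g\<in>G. enat (\<alpha> g) * w i (b g))" if "i \<in> ?I" for i \<alpha>
    by (rule mps_valuation.val_power_product[OF w[OF that] G(1)])
  \<comment> \<open>A series in \<open>P i\<close> that does not vanish on another branch is dominated by some product.\<close>
  have ex_infinite: "\<exists>g\<in>G. w i (b g) = \<infinity>" if i: "i \<in> ?I" for i
  proof -
    obtain k where k: "k \<in> ?I" "k \<noteq> i"
      using i assms(3) that[of 1] that[of 2] by (cases "i = 1") auto
    then have "P k \<noteq> P i"
      using i inj by (auto dest: inj_onD)
    then have "\<not> P i \<subseteq> P k"
      using min_P[OF k(1)] prime[OF i] sub[OF i] by (auto simp: minimal_primes_def)
    then obtain f where f: "f \<in> P i" "f \<notin> P k"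
      by blast
    then obtain \<alpha> where le: "\<forall>i\<in>?I. w i f \<le> w i (prods \<alpha>)"
      using dominating_power_product[OF k(1), of f] w_infinity by blast
    have "w i f = \<infinity>"
      unfolding w_infinity by (rule f(1))
    then have "w i (prods \<alpha>) = \<infinity>"
      using bspec[OF le i] by simp
    then have "(\<Sum>g\<in>G. enat (\<alpha> g) * w i (b g)) = \<infinity>"
      using val_prods[OF i] by simp
    then show ?thesis
      using G(1) by (auto simp: sum_enat_eq_infinity_iff imult_is_infinity)
  qed

  have attained: "\<exists>\<alpha>. w k (prods \<alpha>) = w k f \<and> (\<forall>i\<in>?I. w i f \<le> w i (prods \<alpha>))" if k: "k \<in> ?I" for k f
  proof (cases "w k f = \<infinity>")
    case False
    then show ?thesis
      by (rule dominating_power_product[OF k])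
  next
    case k_infinite: True
    have "\<exists>\<alpha>. \<forall>i\<in>?I. w i f \<le> w i (prods \<alpha>)"
    proof (cases "\<exists>i\<in>?I. w i f \<noteq> \<infinity>")
      case True
      then show ?thesis
        using dominating_power_product by blast
    next
      case False
      have "w i (prods (\<lambda>_. 1)) = \<infinity>" if i: "i \<in> ?I" for i
        using ex_infinite[OF i] G(1)
        by (auto simp: val_prods[OF i] sum_enat_eq_infinity_iff imult_is_infinity zero_enat_def)
      then have "\<forall>i\<in>?I. w i f \<le> w i (prods (\<lambda>_. 1))"
        by simp
      then show ?thesis
        by (intro exI[of _ "\<lambda>_. 1"])
    qed
    then show ?thesis
      using k k_infinite by (metis enat_ord_simps(5))
  qed

  have generated: "\<exists>s\<in>?I. \<exists>\<alpha> :: nat \<Rightarrow> (nat \<Rightarrow> enat) \<Rightarrow> nat.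
      value_vector r P v (?c f) =
        (\<lambda>k\<in>?I. MIN i\<in>{1..s}. \<Sum>\<sigma>\<in>value_vector r P v ` G. enat (\<alpha> i \<sigma>) * \<sigma> k)" for f
  proof -
    let ?v = "value_vector r P v"
    obtain A where A: "\<And>k. k \<in> ?I \<Longrightarrow> w k (prods (A k)) = w k f"
      "\<And>k i. k \<in> ?I \<Longrightarrow> i \<in> ?I \<Longrightarrow> w i f \<le> w i (prods (A k))"
      using attained[of _ f] by metis
    \<comment> \<open>Coefficients belong to values, not to elements of \<open>G\<close>; generators with equal values add up.\<close>
    define \<alpha> where "\<alpha> i \<sigma> = (\<Sum>g\<in>{g \<in> G. ?v g = \<sigma>}. A i g)" for i \<sigma>
    have \<alpha>: "(\<Sum>\<sigma>\<in>?v ` G. enat (\<alpha> i \<sigma>) * \<sigma> k) = w k (prods (A i))" if k: "k \<in> ?I" for i k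
    proof -
      have "enat (\<alpha> i \<sigma>) * \<sigma> k = (\<Sum>g\<in>{g \<in> G. ?v g = \<sigma>}. enat (A i g) * w k (b g))" for \<sigma>
      proof -
        have "enat (\<alpha> i \<sigma>) * \<sigma> k = (\<Sum>g\<in>{g \<in> G. ?v g = \<sigma>}. enat (A i g) * \<sigma> k)"
          by (simp add: \<alpha>_def sum_distrib_right flip: of_nat_eq_enat)
        also have "\<dots> = (\<Sum>g\<in>{g \<in> G. ?v g = \<sigma>}. enat (A i g) * w k (b g))"
          using value_G[OF k] by (intro sum.cong) auto
        finally show ?thesis .
      qed
      then show ?thesis
        by (simp add: val_prods[OF k] sum.image_gen[OF G(1), of _ ?v])
    qed
    have "?v (?c f) = (\<lambda>k\<in>?I. MIN i\<in>?I. \<Sum>\<sigma>\<in>?v ` G. enat (\<alpha> i \<sigma>) * \<sigma> k)"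
    proof
      fix k
      show "?v (?c f) k = (\<lambda>k\<in>?I. MIN i\<in>?I. \<Sum>\<sigma>\<in>?v ` G. enat (\<alpha> i \<sigma>) * \<sigma> k) k"
      proof (cases "k \<in> ?I")
        case k: True
        have "Min ((\<lambda>i. w k (prods (A i))) ` ?I) = w k f"
        proof (rule Min_eqI)
          show "w k f \<in> (\<lambda>i. w k (prods (A i))) ` ?I"
            using A(1)[OF k] k by (intro image_eqI[of _ _ k]) auto
        qed (use A(2) k in auto)
        then show ?thesis
          using k value_coset[OF k] \<alpha>[OF k] by simp
      next
        case False
        then show ?thesis
          by (simp only: value_vector_def restrict_apply if_False)
      qed
    qed
    moreover have "r \<in> ?I"
      using assms(3) by simp
    ultimately show ?thesis
      by blast
  qed

  show ?thesis
    unfolding semiring_generated_def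
  proof (intro conjI ballI)
    show "finite (value_vector r P v ` G)"
      using G(1) by simp
    show "value_vector r P v ` G \<subseteq> value_semiring Q r P v"
      unfolding value_semiring_def carrier_curve_ring using b(2) by blast
  next
    fix \<gamma> assume "\<gamma> \<in> value_semiring Q r P v"
    then obtain f where "\<gamma> = value_vector r P v (?c f)"
      unfolding value_semiring_def carrier_curve_ring by blast
    then show "\<exists>s\<in>?I. \<exists>\<alpha> :: nat \<Rightarrow> (nat \<Rightarrow> enat) \<Rightarrow> nat.
        \<gamma> = (\<lambda>k\<in>?I. MIN i\<in>{1..s}. \<Sum>\<sigma>\<in>value_vector r P v ` G. enat (\<alpha> i \<sigma>) * \<sigma> k)"
      using generated by simp
  qed
qed

end
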